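(* Let $A \in \mathbb{C}^{n\times n}$ be Hermitian positive definite with smallest and largest eigenvalues $\lambda_{\min}$ and $\lambda_{\max}$, respectively, and let $\kappa(A) = \lambda_{\max}/\lambda_{\min}$. Let $\mathbf{b} \in \mathbb{C}^n$ with $\|\mathbf{b}\| = 1$, and let $f$ be a Stieltjes function. Let $M$ be the invariance index of the Krylov subspaces of $A$ and $\mathbf{b}$, and let $1 \le m \le M$. Then the $m$th Lanczos approximation $\mathbf{f}_m$ for $f(A)\mathbf{b}$ satisfies $$\|f(A)\mathbf{b}-\mathbf{f}_m\| \leq \left(1+\beta_{m+1}\frac{\lambda_{\max}}{\lambda_{\min}^2}\right) \min_{p \in \Pi_{m-1}}\|f(A)\mathbf{b}-p(A)\mathbf{b}\| \leq \left(1+\kappa(A)^2\right) \min_{p \in \Pi_{m-1}}\|f(A)\mathbf{b}-p(A)\mathbf{b}\|,$$ where $\beta_{m+1}$ is the coefficient produced in step $m$ of the Lanczos method applied to $A$ and $\mathbf{b}$.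
   Context: Exact arithmetic is assumed; $\|\cdot\|$ is the Euclidean norm; $(\cdot)^*$ is the conjugate transpose; $\Pi_{k}$ is the space of (complex) polynomials of degree at most $k$; $\mathbf{e}_i^{(k)}$ is the $i$th canonical unit vector of length $k$. Monotone is meant in the non-strict sense. Krylov subspaces: $\mathcal{K}_m(A,\mathbf{b}) = \operatorname{span}\{\mathbf{b},A\mathbf{b},\dots,A^{m-1}\mathbf{b}\} = \{p(A)\mathbf{b} : p \in \Pi_{m-1}\}$. The invariance index $M$ is the smallest $M$ such that $\mathcal{K}_{m+1}(A,\mathbf{b}) = \mathcal{K}_m(A,\mathbf{b})$ for all $m \ge M$. Lanczos method: set $\mathbf{v}_0 = \mathbf{0}$, $\mathbf{v}_1 = \mathbf{b}$, $\beta_1 = 0$. For $j = 1,2,\dots,M$: $\mathbf{w}_j = A\mathbf{v}_j - \beta_j \mathbf{v}_{j-1}$; $\alpha_j = \mathbf{v}_j^*\mathbf{w}_j$; replace $\mathbf{w}_j$ by $\mathbf{w}_j - \alpha_j\mathbf{v}_j$; $\beta_{j+1} = \|\mathbf{w}_j\|$; and, if $\beta_{j+1} \neq 0$, $\mathbf{v}_{j+1} = \mathbf{w}_j/\beta_{j+1}$. One has $\beta_{j+1} > 0$ for $j<M$ and $\beta_{M+1}=0$. The vectors $\mathbf{v}_1,\dots,\mathbf{v}_m$ form an orthonormal basis of $\mathcal{K}_m(A,\mathbf{b})$ for $m \le M$. Put $V_m = [\mathbf{v}_1 \mid \dots \mid \mathbf{v}_m] \in \mathbb{C}^{n\times m}$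 and let $T_m = V_m^*AV_m \in \mathbb{R}^{m\times m}$, which is the symmetric tridiagonal matrix with diagonal entries $\alpha_1,\dots,\alpha_m$ and off-diagonal entries $\beta_2,\dots,\beta_m$. The $m$th Lanczos approximation for $f(A)\mathbf{b}$ is $\mathbf{f}_m = V_m f(T_m)\mathbf{e}_1^{(m)}$. Stieltjes function: a function of the form $f(z) = \int_0^\infty \frac{1}{z+t}\,\mathrm{d}\mu(t)$ for $z \in (0,\infty)$, where $\mu:[0,\infty)\to\mathbb{R}$ is monotonically increasing and such that $\int_0^\infty \frac{1}{1+t}\,\mathrm{d}\mu(t) < \infty$ (an atom of the nonnegative measure $\mathrm{d}\mu$ at $t=0$ is allowed, so that e.g. $f(z)=1/z$ is a Stieltjes function). *)

theory Defs
  imports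
    "HOL-Analysis.Analysis"
    "Jordan_Normal_Form.Schur_Decomposition"
    "Jordan_Normal_Form.VS_Connect"
begin

unbundle no vec_syntax
unbundle no inner_syntax

section \<open>Vectors and Hermitian matrices\<close>

definition vnorm :: "complex vec \<Rightarrow> real" where
  "vnorm v = L2_set (\<lambda>i. cmod (v $ i)) {..<dim_vec v}"

definition hermitian_mat :: "complex mat \<Rightarrow> bool" where
  "hermitian_mat A \<longleftrightarrow> mat_adjoint A = A"

text \<open>Here \<open>x \<bullet>c y\<close> conjugates its second argument, so \<open>(A *\<^sub>v x) \<bullet>c x\<close> is
  the quadratic form \<open>x\<^sup>* A x\<close>; it is real for Hermitian \<open>A\<close>.\<close>

definition hermitian_pos_def :: "complex mat \<Rightarrow> bool" where
  "hermitian_pos_def A \<longleftrightarrow> hermitian_mat A \<and>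
     (\<forall>x \<in> carrier_vec (dim_row A). x \<noteq> 0\<^sub>v (dim_row A) \<longrightarrow> 0 < Re ((A *\<^sub>v x) \<bullet>c x))"

text \<open>Only meant for Hermitian matrices, all of whose eigenvalues are real.\<close>

definition lambda_min :: "complex mat \<Rightarrow> real" where
  "lambda_min A = Min {x. eigenvalue A (complex_of_real x)}"

definition lambda_max :: "complex mat \<Rightarrow> real" where
  "lambda_max A = Max {x. eigenvalue A (complex_of_real x)}"

definition condition_number :: "complex mat \<Rightarrow> real" where
  "condition_number A = lambda_max A / lambda_min A"

section \<open>Functions of matrices\<close>

definition poly_mat :: "complex poly \<Rightarrow> complex mat \<Rightarrow> complex mat" where
  "poly_mat p A = Matrix.mat (dim_row A) (dim_row A)
     (\<lambda>ij. \<Sum>k\<le>degree p. coeff p k * (A ^\<^sub>m k) $$ ij)"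

definition spectral_decomposition :: "complex mat \<Rightarrow> complex mat \<Rightarrow> (nat \<Rightarrow> real) \<Rightarrow> bool" where
  "spectral_decomposition A U d \<longleftrightarrow>
     U \<in> carrier_mat (dim_row A) (dim_row A) \<and>
     mat_adjoint U * U = 1\<^sub>m (dim_row A) \<and>
     A = U * mat_diag (dim_row A) (\<lambda>i. complex_of_real (d i)) * mat_adjoint U"

text \<open>For Hermitian \<open>A\<close>: \<open>f(A) = U diag(f(d\<^sub>1), \<dots>, f(d\<^sub>n)) U\<^sup>*\<close> whenever
  \<open>A = U diag(d\<^sub>1, \<dots>, d\<^sub>n) U\<^sup>*\<close> with \<open>U\<close> unitary. A decomposition exists by the spectral
  theorem, and by \<open>mat_fun_unique\<close> the result does not depend on it.\<close>

definition mat_fun :: "(real \<Rightarrow> real) \<Rightarrow> complex mat \<Rightarrow> complex mat" where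
  "mat_fun f A = (THE B. \<exists>U d. spectral_decomposition A U d \<and>
     B = U * mat_diag (dim_row A) (\<lambda>i. complex_of_real (f (d i))) * mat_adjoint U)"

lemma mat_fun_unique:
  assumes U: "spectral_decomposition A U d" and V: "spectral_decomposition A V e"
  shows "U * mat_diag (dim_row A) (\<lambda>i. complex_of_real (f (d i))) * mat_adjoint U =
         V * mat_diag (dim_row A) (\<lambda>i. complex_of_real (f (e i))) * mat_adjoint V"
proof -
  define n where "n = dim_row A"
  define D where "D g h = mat_diag n (\<lambda>i. complex_of_real (g (h i)))"
    for g :: "real \<Rightarrow> real" and h :: "nat \<Rightarrow> real"
  define U' V' where "U' = mat_adjoint U" and "V' = mat_adjoint V"
  define W where "W = V' * U"
  have U_c: "U \<in> carrier_mat n n" and V_c: "V \<in> carrier_mat n n"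
    using U V by (auto simp: spectral_decomposition_def n_def)
  have U'_c: "U' \<in> carrier_mat n n" and V'_c: "V' \<in> carrier_mat n n"
    using U_c V_c by (auto simp: U'_def V'_def mat_adjoint_def mat_of_rows_def)
  have D_c: "D g h \<in> carrier_mat n n" for g h by (simp add: D_def)
  have W_c: "W \<in> carrier_mat n n" using V'_c U_c by (simp add: W_def)
  note c = U_c V_c U'_c V'_c D_c W_c
  have u: "U' * U = 1\<^sub>m n" and v: "V' * V = 1\<^sub>m n"
    using U V by (auto simp: spectral_decomposition_def n_def U'_def V'_def)
  have u2: "U * U' = 1\<^sub>m n" and v2: "V * V' = 1\<^sub>m n"
    using mat_mult_left_right_inverse u v c by blast+
  have m_c: "X * Y \<in> carrier_mat n n"
    if "X \<in> carrier_mat n n" "Y \<in> carrier_mat n n" for X Y :: "complex mat"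
    using that by (rule mult_carrier_mat)
  have assoc: "X * Y * Z = X * (Y * Z)"
    if "X \<in> carrier_mat n n" "Y \<in> carrier_mat n n" "Z \<in> carrier_mat n n"
    for X Y Z :: "complex mat"
    using that by (rule assoc_mult_mat)
  note mats = assoc m_c c right_mult_one_mat[of _ n n] left_mult_one_mat[of _ n n]
  have A: "U * (D id d * U') = V * (D id e * V')"
    using U V c by (simp add: spectral_decomposition_def D_def n_def[symmetric]
        U'_def[symmetric] V'_def[symmetric] assoc_mult_mat[of _ n n _ n _ n])
  have "W * D id d = V' * (U * (D id d * U')) * U"
    by (simp add: W_def mats u del: mult_carrier_mat)
  also have "\<dots> = (V' * V) * (D id e * (V' * U))"
    unfolding A by (simp add: mats del: mult_carrier_mat)
  also have "\<dots> = D id e * W"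
    by (simp add: v W_def mats)
  finally have comm: "W * D id d = D id e * W" .
  have "W $$ (i, j) * complex_of_real (f (d j)) = complex_of_real (f (e i)) * W $$ (i, j)"
    if "i < n" "j < n" for i j
  proof -
    have "(W * D id d) $$ (i, j) = (D id e * W) $$ (i, j)"
      by (simp only: comm)
    then have "W $$ (i, j) * complex_of_real (d j) = complex_of_real (e i) * W $$ (i, j)"
      using that by (simp add: D_def mat_diag_mult_right[OF W_c] mat_diag_mult_left[OF W_c])
    then show ?thesis by (cases "W $$ (i, j) = 0") auto
  qed
  then have comm': "W * D f d = D f e * W"
    by (intro eq_matI)
      (auto simp: D_def mat_diag_mult_right[OF W_c] mat_diag_mult_left[OF W_c])
  have "U * (D f d * U') = (V * V') * (U * (D f d * U'))"
    by (simp add: v2 mats del: mult_carrier_mat)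
  also have "\<dots> = V * (W * D f d) * U'"
    by (simp add: W_def mats del: mult_carrier_mat)
  also have "\<dots> = V * (D f e * (V' * (U * U')))"
    unfolding comm' by (simp add: W_def mats del: mult_carrier_mat)
  also have "\<dots> = V * (D f e * V')"
    by (simp add: u2 mats)
  finally show ?thesis
    using c by (simp add: D_def n_def[symmetric] U'_def[symmetric] V'_def[symmetric]
        assoc_mult_mat[of _ n n _ n _ n])
qed

lemma mat_fun_eq:
  assumes "spectral_decomposition A U d"
  shows "mat_fun f A =
    U * mat_diag (dim_row A) (\<lambda>i. complex_of_real (f (d i))) * mat_adjoint U"
  unfolding mat_fun_def
  by (rule the_equality) (use assms mat_fun_unique in blast)+

section \<open>Krylov subspaces and the Lanczos method\<close>

definition krylov :: "complex mat \<Rightarrow> complex vec \<Rightarrow> nat \<Rightarrow> complex vec set" where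
  "krylov A b m = module.span class_ring (module_vec TYPE(complex) (dim_vec b))
     ((\<lambda>j. (A ^\<^sub>m j) *\<^sub>v b) ` {..<m})"

definition invariance_index :: "complex mat \<Rightarrow> complex vec \<Rightarrow> nat" where
  "invariance_index A b = (LEAST M. \<forall>m\<ge>M. krylov A b (Suc m) = krylov A b m)"

text \<open>\<open>lanczos_w A b j\<close> is the value of \<open>w\<^sub>j\<close> after the subtraction of \<open>\<alpha>\<^sub>j v\<^sub>j\<close>.
  The values \<open>lanczos_w A b 0\<close> and \<open>lanczos_beta A b 0\<close>, and \<open>v\<^sub>j\<^sub>+\<^sub>1\<close> for
  \<open>\<beta>\<^sub>j\<^sub>+\<^sub>1 = 0\<close>, are not part of the method and only make the functions total.\<close>

fun lanczos_v :: "complex mat \<Rightarrow> complex vec \<Rightarrow> nat \<Rightarrow> complex vec"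
  and lanczos_w :: "complex mat \<Rightarrow> complex vec \<Rightarrow> nat \<Rightarrow> complex vec"
  and lanczos_beta :: "complex mat \<Rightarrow> complex vec \<Rightarrow> nat \<Rightarrow> real"
where
  "lanczos_v A b 0 = 0\<^sub>v (dim_vec b)"
| "lanczos_v A b (Suc 0) = b"
| "lanczos_v A b (Suc (Suc j)) =
     (let \<beta> = lanczos_beta A b (Suc (Suc j)) in
      if \<beta> \<noteq> 0 then complex_of_real (1 / \<beta>) \<cdot>\<^sub>v lanczos_w A b (Suc j) else 0\<^sub>v (dim_vec b))"
| "lanczos_w A b 0 = 0\<^sub>v (dim_vec b)"
| "lanczos_w A b (Suc j) =
     (let v = lanczos_v A b (Suc j);
          w = A *\<^sub>v v - complex_of_real (lanczos_beta A b (Suc j)) \<cdot>\<^sub>v lanczos_v A b j;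
          \<alpha> = w \<bullet>c v
      in w - \<alpha> \<cdot>\<^sub>v v)"
| "lanczos_beta A b 0 = 0"
| "lanczos_beta A b (Suc 0) = 0"
| "lanczos_beta A b (Suc (Suc j)) = vnorm (lanczos_w A b (Suc j))"

definition lanczos_V :: "complex mat \<Rightarrow> complex vec \<Rightarrow> nat \<Rightarrow> complex mat" where
  "lanczos_V A b m = mat_of_cols (dim_vec b) (map (lanczos_v A b) [1..<Suc m])"

definition lanczos_T :: "complex mat \<Rightarrow> complex vec \<Rightarrow> nat \<Rightarrow> complex mat" where
  "lanczos_T A b m = mat_adjoint (lanczos_V A b m) * A * lanczos_V A b m"

definition lanczos_approx :: "(real \<Rightarrow> real) \<Rightarrow> complex mat \<Rightarrow> complex vec \<Rightarrow> nat \<Rightarrow> complex vec" where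
  "lanczos_approx f A b m =
     lanczos_V A b m *\<^sub>v (mat_fun f (lanczos_T A b m) *\<^sub>v unit_vec m 0)"

section \<open>Stieltjes functions\<close>

text \<open>The Lebesgue--Stieltjes measure \<open>d\<mu>\<close> of an increasing \<open>\<mu> : [0,\<infinity>) \<rightarrow> \<real>\<close>.
  Since \<open>interval_measure\<close> needs a right-continuous function on all of \<open>\<real>\<close>, \<open>\<mu>\<close> is
  replaced by its right limits on \<open>[0,\<infinity>)\<close> and extended by the constant \<open>\<mu> 0\<close> to the left
  (the result is increasing and right-continuous, see the lemma below), so that \<open>d\<mu>\<close> has the atom \<open>\<mu>(0+) - \<mu>(0)\<close> at \<open>0\<close> and no mass on the negative axis.\<close>

definition right_limits :: "(real \<Rightarrow> real) \<Rightarrow> real \<Rightarrow> real" where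
  "right_limits \<mu> x = (if x < 0 then \<mu> 0 else (INF s\<in>{x<..}. \<mu> s))"

lemma
  assumes "mono_on {0..} \<mu>"
  shows right_limits_mono: "x \<le> y \<Longrightarrow> right_limits \<mu> x \<le> right_limits \<mu> y"
    and right_limits_right_continuous: "continuous (at_right x) (right_limits \<mu>)"
proof -
  have \<mu>: "\<mu> s \<le> \<mu> t" if "0 \<le> s" "s \<le> t" for s t
    using assms that by (auto simp: mono_on_def)
  have bdd: "bdd_below (\<mu> ` {x<..})" if "0 \<le> x" for x
    using that by (intro bdd_belowI[of _ "\<mu> x"]) (auto intro: \<mu>)
  have upper: "right_limits \<mu> x \<le> \<mu> s" if "x < s" "0 \<le> s" for x s
    using that by (cases "x < 0") (auto simp: right_limits_def intro: \<mu> cINF_lower[OF bdd])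
  have lower: "\<mu> 0 \<le> right_limits \<mu> x" for x
    by (auto simp: right_limits_def intro!: cINF_greatest \<mu>)
  show mono: "right_limits \<mu> x \<le> right_limits \<mu> y" if "x \<le> y" for x y
  proof (cases "x < 0")
    case True
    then show ?thesis using lower[of y] by (simp add: right_limits_def)
  next
    case False
    then have "right_limits \<mu> y = (INF s\<in>{y<..}. \<mu> s)"
      using that by (simp add: right_limits_def)
    also have "\<dots> \<ge> right_limits \<mu> x"
      using False that by (intro cINF_greatest upper) auto
    finally show ?thesis .
  qed
  show "continuous (at_right x) (right_limits \<mu>)"
  proof (cases "x < 0")
    case True
    then have "eventually (\<lambda>y. right_limits \<mu> y = right_limits \<mu> x) (at_right x)"
      by (auto simp: eventually_at_right_field right_limits_def intro!: exI[of _ 0])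
    then show ?thesis
      unfolding continuous_within by (rule tendsto_eventually)
  next
    case False
    show ?thesis
      unfolding continuous_within
    proof (rule order_tendstoI)
      fix a assume "a < right_limits \<mu> x"
      then show "eventually (\<lambda>y. a < right_limits \<mu> y) (at_right x)"
        using mono by (auto simp: eventually_at_right_field less_le_trans
            intro!: exI[of _ "x + 1"] less_le_trans[OF \<open>a < right_limits \<mu> x\<close>])
    next
      fix a assume "right_limits \<mu> x < a"
      then obtain s where s: "x < s" "\<mu> s < a"
        using False bdd[of x] by (auto simp: right_limits_def cINF_less_iff)
      then show "eventually (\<lambda>y. right_limits \<mu> y < a) (at_right x)"
        using False by (auto simp: eventually_at_right_field
            intro!: exI[of _ s] le_less_trans[OF upper])
    qed
  qed
qed

definition stieltjes_measure :: "(real \<Rightarrow> real) \<Rightarrow> real measure" where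
  "stieltjes_measure \<mu> = interval_measure (right_limits \<mu>)"

definition stieltjes_function :: "(real \<Rightarrow> real) \<Rightarrow> bool" where
  "stieltjes_function f \<longleftrightarrow> (\<exists>\<mu>. mono_on {0..} \<mu> \<and>
     set_integrable (stieltjes_measure \<mu>) {0..} (\<lambda>t. 1 / (1 + t)) \<and>
     (\<forall>z>0. f z = (LINT t:{0..}|stieltjes_measure \<mu>. 1 / (z + t))))"

end

theory Submission
  imports Defs "Jordan_Normal_Form.Spectral_Radius"
begin

text \<open>
  The argument becomes one about polynomials on finitely many points. Diagonalise
  \<open>A = U diag(d\<^sub>1, \<dots>, d\<^sub>n) U\<^sup>*\<close> and put \<open>c = U\<^sup>* b\<close>. Then \<open>g(A) b\<close> has spectral coordinates
  \<open>g(d\<^sub>i) c\<^sub>i\<close>, so inner products of such vectors are those of the functions \<open>g\<close> with respect to the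
  discrete measure with mass \<open>\<bar>c\<^sub>i\<bar>\<^sup>2\<close> at \<open>d\<^sub>i\<close>, and the Lanczos vector \<open>v\<^sub>j\<close> is \<open>P\<^sub>j(A) b\<close> for the
  real orthonormal polynomial \<open>P\<^sub>j\<close> of degree \<open>j - 1\<close> given by the three-term recurrence. Let
  \<open>R\<close> be the residual of that recurrence in step \<open>m\<close>, that is, \<open>P\<^sub>m\<^sub>+\<^sub>1\<close> before normalisation, so
  that \<open>R(A) b\<close> is \<open>w\<^sub>m\<close> and has norm \<open>\<beta>\<^sub>m\<^sub>+\<^sub>1\<close>.

  The error \<open>f(A) b - f\<^sub>m\<close> is the sum of the part orthogonal to the Krylov space, whose norm is the
  minimum \<open>E\<close> over polynomials of degree at most \<open>m - 1\<close>, and the vector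
  \<open>V\<^sub>m (V\<^sub>m\<^sup>* f(A) b - f(T\<^sub>m) e\<^sub>1)\<close> inside it. For a single resolvent, \<open>y(t) = V\<^sub>m\<^sup>* (A + t)\<^sup>-\<^sup>1 b\<close>
  satisfies \<open>(T\<^sub>m + t) y(t) = e\<^sub>1 - g(t) e\<^sub>m\<close>, where \<open>g(t)\<close> is the inner product of \<open>R\<close> with
  \<open>1 / (x + t)\<close> (\<open>compressed_shift\<close>). Hence the second part is, up to the isometry \<open>V\<^sub>m\<close>, the integral of
  \<open>- g(t) (T\<^sub>m + t)\<^sup>-\<^sup>1 e\<^sub>m\<close> against the Stieltjes measure, and as the eigenvalues of \<open>T\<^sub>m\<close> are at least
  \<open>\<lambda>\<^sub>m\<^sub>i\<^sub>n\<close>, its norm is at most the integral of \<open>\<bar>g\<bar>\<close> divided by \<open>\<lambda>\<^sub>m\<^sub>i\<^sub>n\<close>.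

  The crucial point is that \<open>g\<close> does not change sign (\<open>residual_resolvent_one_signed\<close>), so that the
  absolute value can be moved outside the integral (\<open>one_signed_weighted_integral\<close>). The integral of \<open>g\<close>
  is the inner product of \<open>R\<close> with \<open>f\<close>, which by orthogonality is that of \<open>R\<close> with \<open>f - p\<close> for the best
  approximation \<open>p\<close>, and thus at most \<open>\<beta>\<^sub>m\<^sub>+\<^sub>1 E\<close>. This gives the factor \<open>1 + \<beta>\<^sub>m\<^sub>+\<^sub>1 / \<lambda>\<^sub>m\<^sub>i\<^sub>n\<close>
  (\<open>lanczos_stieltjes_error\<close>), which is at most the first factor of the theorem because
  \<open>\<lambda>\<^sub>m\<^sub>a\<^sub>x / \<lambda>\<^sub>m\<^sub>i\<^sub>n \<ge> 1\<close>; the second factor follows from \<open>\<beta>\<^sub>m\<^sub>+\<^sub>1 \<le> \<lambda>\<^sub>m\<^sub>a\<^sub>x\<close> (\<open>beta_le\<close>).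
\<close>

section \<open>Adjoints and the Euclidean norm\<close>

lemma dim_mat_adjoint [simp]:
  "dim_row (mat_adjoint A) = dim_col A" "dim_col (mat_adjoint A) = dim_row A"
  by (simp_all add: mat_adjoint_def)

lemma mat_adjoint_carrier [simp]: "A \<in> carrier_mat n m \<Longrightarrow> mat_adjoint A \<in> carrier_mat m n"
  by auto

lemma index_mat_adjoint [simp]:
  assumes "i < dim_col A" "j < dim_row A"
  shows "mat_adjoint A $$ (i, j) = cnj ((A :: complex mat) $$ (j, i))"
  using assms by (simp add: mat_adjoint_def mat_of_rows_index)

lemma mat_adjoint_adjoint [simp]: "mat_adjoint (mat_adjoint A) = (A :: complex mat)"
  by (intro eq_matI) auto

lemma index_mult_mat_sum:
  assumes "A \<in> carrier_mat n m" "B \<in> carrier_mat m l" "i < n" "j < l"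
  shows "(A * B) $$ (i, j) = (\<Sum>k<m. A $$ (i, k) * (B $$ (k, j) :: complex))"
  using assms by (auto simp: scalar_prod_def lessThan_atLeast0 intro!: sum.cong)

lemma index_mult_mat_vec_sum:
  assumes "A \<in> carrier_mat n m" "x \<in> carrier_vec m" "i < n"
  shows "(A *\<^sub>v x) $ i = (\<Sum>k<m. A $$ (i, k) * (x $ k :: complex))"
  using assms by (auto simp: scalar_prod_def lessThan_atLeast0 intro!: sum.cong)

lemma cscalar_prod_sum:
  assumes "y \<in> carrier_vec n"
  shows "x \<bullet>c y = (\<Sum>i<n. x $ i * cnj (y $ i))"
  using assms by (auto simp: scalar_prod_def lessThan_atLeast0 intro!: sum.cong)

lemma mat_adjoint_mult:
  assumes "A \<in> carrier_mat n m" "B \<in> carrier_mat m l"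
  shows "mat_adjoint (A * B) = mat_adjoint B * mat_adjoint (A :: complex mat)"
  using assms by (intro eq_matI)
    (auto simp: scalar_prod_def mult.commute intro!: sum.cong)

lemma mat_adjoint_mat_diag_real:
  "mat_adjoint (mat_diag n (\<lambda>i. complex_of_real (d i))) = mat_diag n (\<lambda>i. complex_of_real (d i))"
  by (intro eq_matI) (auto simp: mat_diag_def)

lemma cscalar_prod_mult_mat_vec:
  fixes A :: "complex mat"
  assumes A: "A \<in> carrier_mat n m" and x: "x \<in> carrier_vec m" and y: "y \<in> carrier_vec n"
  shows "(A *\<^sub>v x) \<bullet>c y = x \<bullet>c (mat_adjoint A *\<^sub>v y)"
proof -
  have "(A *\<^sub>v x) \<bullet>c y = (\<Sum>i<n. \<Sum>k<m. A $$ (i, k) * x $ k * cnj (y $ i))"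
    using assms by (simp add: cscalar_prod_sum[OF y] index_mult_mat_vec_sum[OF A x] sum_distrib_right
        del: index_mult_mat_vec)
  also have "\<dots> = (\<Sum>k<m. \<Sum>i<n. A $$ (i, k) * x $ k * cnj (y $ i))"
    by (rule sum.swap)
  also have "\<dots> = (\<Sum>k<m. x $ k * cnj (\<Sum>i<n. cnj (A $$ (i, k)) * y $ i))"
    by (simp add: sum_distrib_left mult_ac)
  also have "\<dots> = x \<bullet>c (mat_adjoint A *\<^sub>v y)"
    using A y mult_mat_vec_carrier[of "mat_adjoint A" m n y] by (subst cscalar_prod_sum[of _ m])
      (auto simp: index_mult_mat_vec_sum[of _ m n] simp del: index_mult_mat_vec intro!: sum.cong)
  finally show ?thesis .
qed

lemma isometry_cscalar_prod:
  fixes U :: "complex mat"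
  assumes U: "U \<in> carrier_mat n m" "mat_adjoint U * U = 1\<^sub>m m"
    and "x \<in> carrier_vec m" "y \<in> carrier_vec m"
  shows "(U *\<^sub>v x) \<bullet>c (U *\<^sub>v y) = x \<bullet>c y"
proof -
  have "mat_adjoint U *\<^sub>v (U *\<^sub>v y) = y"
    using assms by (subst assoc_mult_mat_vec[symmetric, of _ m n _ m]) auto
  then show ?thesis
    using assms by (subst cscalar_prod_mult_mat_vec[of _ n m]) auto
qed

lemma cscalar_prod_self: "x \<bullet>c x = complex_of_real ((vnorm x)\<^sup>2)"
  by (simp add: cscalar_prod_sum[of _ "dim_vec x"] vnorm_def L2_set_def sum_nonneg complex_norm_square
      del: of_real_power)

lemma vnorm_square_sum: "(vnorm x)\<^sup>2 = (\<Sum>i<dim_vec x. (cmod (x $ i))\<^sup>2)"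
  by (simp add: vnorm_def L2_set_def sum_nonneg)

lemma vnorm_nonneg [simp]: "0 \<le> vnorm x"
  by (simp add: vnorm_def)

lemma vnorm_eq_0_iff: "x \<in> carrier_vec n \<Longrightarrow> vnorm x = 0 \<longleftrightarrow> x = 0\<^sub>v n"
  by (metis conjugate_square_eq_0_vec cscalar_prod_self of_real_eq_0_iff zero_eq_power2)

lemma vnorm_add_le:
  assumes "x \<in> carrier_vec n" "y \<in> carrier_vec n"
  shows "vnorm (x + y) \<le> vnorm x + vnorm y"
proof -
  have "vnorm (x + y) = L2_set (\<lambda>i. cmod (x $ i + y $ i)) {..<n}"
    using assms by (auto simp: vnorm_def L2_set_def intro!: sum.cong)
  also have "\<dots> \<le> L2_set (\<lambda>i. cmod (x $ i) + cmod (y $ i)) {..<n}"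
    by (intro L2_set_mono norm_triangle_ineq) auto
  also have "\<dots> \<le> vnorm x + vnorm y"
    using assms L2_set_triangle_ineq by (auto simp: vnorm_def)
  finally show ?thesis .
qed

lemma isometry_vnorm:
  assumes "U \<in> carrier_mat n m" "mat_adjoint U * U = 1\<^sub>m m" "x \<in> carrier_vec m"
  shows "vnorm (U *\<^sub>v x) = vnorm x"
proof -
  have "(vnorm (U *\<^sub>v x))\<^sup>2 = (vnorm x)\<^sup>2"
    using isometry_cscalar_prod[OF assms assms(3)] by (simp only: cscalar_prod_self of_real_eq_iff)
  then show ?thesis by simp
qed

lemma vnorm_le_by_entries:
  assumes x: "x \<in> carrier_vec m" and y: "y \<in> carrier_vec m" and c: "0 \<le> c"
    and le: "\<And>k. k < m \<Longrightarrow> cmod (x $ k) \<le> c * cmod (y $ k)"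
  shows "vnorm x \<le> c * vnorm y"
proof -
  have "vnorm x \<le> L2_set (\<lambda>k. c * cmod (y $ k)) {..<m}"
    using x le unfolding vnorm_def by (auto intro!: L2_set_mono)
  also have "\<dots> = c * vnorm y"
    using y c by (simp add: vnorm_def L2_set_right_distrib)
  finally show ?thesis .
qed

section \<open>The spectral theorem for Hermitian matrices\<close>

lemma hermitian_eigenvalue_real:
  assumes "A \<in> carrier_mat n n" "hermitian_mat A" "u \<in> carrier_vec n" "u \<bullet>c u = 1"
    and ev: "A *\<^sub>v u = \<mu> \<cdot>\<^sub>v u"
  shows "\<mu> = complex_of_real (Re \<mu>)"
proof -
  have "(A *\<^sub>v u) \<bullet>c u = u \<bullet>c (A *\<^sub>v u)"
    using assms cscalar_prod_mult_mat_vec[of A n n u u] by (simp add: hermitian_mat_def)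
  then have "\<mu> = cnj \<mu>"
    using assms by (simp add: conjugate_smult_vec)
  then show ?thesis
    by (metis Reals_cnj_iff of_real_Re)
qed

text \<open>The squared moduli of the entries of \<open>V\<close> sum to \<open>k\<close> when added up by columns, and would
  sum to \<open>n\<close> when added up by rows if \<open>V V\<^sup>*\<close> were the identity.\<close>

lemma isometry_not_coisometry:
  fixes V :: "complex mat"
  assumes V: "V \<in> carrier_mat n k" "mat_adjoint V * V = 1\<^sub>m k" and "k \<noteq> n"
  shows "V * mat_adjoint V \<noteq> 1\<^sub>m n"
proof
  assume co: "V * mat_adjoint V = 1\<^sub>m n"
  have "of_nat n = (\<Sum>i<n. (V * mat_adjoint V) $$ (i, i))"
    by (simp add: co)
  also have "\<dots> = (\<Sum>i<n. \<Sum>j<k. V $$ (i, j) * cnj (V $$ (i, j)))"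
    using V by (auto simp: index_mult_mat_sum[of _ n k _ n] simp del: index_mult_mat intro!: sum.cong)
  also have "\<dots> = (\<Sum>j<k. \<Sum>i<n. cnj (V $$ (i, j)) * V $$ (i, j))"
    by (subst sum.swap) (simp add: mult.commute)
  also have "\<dots> = (\<Sum>j<k. (mat_adjoint V * V) $$ (j, j))"
    using V(1) by (auto simp: index_mult_mat_sum[of _ k n _ k] simp del: index_mult_mat intro!: sum.cong)
  also have "\<dots> = of_nat k"
    unfolding V(2) by simp
  finally show False using \<open>k \<noteq> n\<close> by simp
qed

lemma similar_upper_triangular:
  assumes A: "A \<in> carrier_mat n n"
  obtains B P Q :: "complex mat" where "similar_mat_wit A B P Q" "upper_triangular B"
proof -
  obtain as where "char_poly A = (\<Prod>a\<leftarrow>as. [:- a, 1:])"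
    using char_poly_factorized[OF A] by blast
  then show ?thesis
    using that schur_decomposition_exists[OF A] unfolding similar_mat_def by blast
qed

text \<open>The induction step of the spectral theorem. The projection \<open>S = 1 - V V\<^sup>*\<close> onto the orthogonal
  complement of the eigenvectors found so far commutes with \<open>A\<close>. Take a basis \<open>P\<close> in which \<open>A\<close> is
  upper triangular: \<open>A\<close> maps its \<open>l\<close>-th vector to a multiple of that vector plus earlier ones.
  After projection by \<open>S\<close>, the first basis vector that is not annihilated is therefore an
  eigenvector, as all earlier ones vanish.\<close>

lemma orthogonal_eigenvector_exists:
  assumes A: "A \<in> carrier_mat n n" "hermitian_mat A"
    and V: "V \<in> carrier_mat n k" "mat_adjoint V * V = 1\<^sub>m k"
    and AV: "A * V = V * mat_diag k (\<lambda>i. complex_of_real (\<theta> i))" and k: "k \<noteq> n"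
  shows "\<exists>u \<mu>. u \<in> carrier_vec n \<and> u \<bullet>c u = 1 \<and> mat_adjoint V *\<^sub>v u = 0\<^sub>v k \<and>
    A *\<^sub>v u = complex_of_real \<mu> \<cdot>\<^sub>v u"
proof -
  define D where "D = mat_diag k (\<lambda>i. complex_of_real (\<theta> i))"
  define W where "W = mat_adjoint V"
  define S where "S = 1\<^sub>m n - V * W"
  have D: "D \<in> carrier_mat k k" and W: "W \<in> carrier_mat k n"
    using V by (auto simp: D_def W_def)
  have VW: "V * W \<in> carrier_mat n n" using V W by auto
  have S: "S \<in> carrier_mat n n" using VW unfolding S_def by (intro minus_carrier_mat)
  have WA: "W * A = D * W"
  proof -
    have "mat_adjoint (A * V) = mat_adjoint (V * D)"
      using AV by (simp add: D_def)
    then show ?thesis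
      using A V D by (simp add: mat_adjoint_mult[of _ n n _ k] mat_adjoint_mult[of _ n k _ k] W_def
          hermitian_mat_def D_def mat_adjoint_mat_diag_real)
  qed
  have "A * (V * W) = V * D * W"
    using A V W by (simp add: assoc_mult_mat[symmetric, of _ n n _ k _ n] AV D_def)
  also have "\<dots> = V * W * A"
    using A V W D by (simp add: assoc_mult_mat[of _ n k _ k _ n] assoc_mult_mat[of _ n k _ n _ n] WA)
  finally have "A * S = S * A"
    using A VW by (simp add: S_def mult_minus_distrib_mat[of _ n n _ n] minus_mult_distrib_mat[of _ n n])
  have WS: "W * S = 0\<^sub>m k n"
    using V W VW by (simp add: S_def mult_minus_distrib_mat[of _ k n _ n]
        assoc_mult_mat[symmetric, of _ k n _ k _ n] W_def)
  obtain B P Q where sim: "similar_mat_wit A B P Q" and B: "upper_triangular B"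
    using similar_upper_triangular[OF A(1)] by blast
  note PQ = similar_mat_witD2[OF A(1) sim]
  define Y where "Y = S * P"
  have Y: "Y \<in> carrier_mat n n" using S PQ by (simp add: Y_def)
  have AY: "A * Y = Y * B"
  proof -
    have "A * Y = S * (A * P)"
      using A S PQ \<open>A * S = S * A\<close>
      by (simp add: Y_def assoc_mult_mat[symmetric, of _ n n _ n _ n] del: assoc_mult_mat)
    also have "A * P = P * B"
      using PQ by (simp add: PQ(3) assoc_mult_mat[of _ n n _ n _ n])
    finally show ?thesis
      using S PQ by (simp add: Y_def assoc_mult_mat[of _ n n _ n _ n])
  qed
  \<comment> \<open>Otherwise \<open>S = 0\<close>, that is, \<open>V\<close> would already be unitary.\<close>
  have "\<exists>l<n. col Y l \<noteq> 0\<^sub>v n"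
  proof (rule ccontr)
    assume "\<not> ?thesis"
    then have "Y = 0\<^sub>m n n"
      using Y by (intro eq_matI) (auto simp: vec_eq_iff)
    moreover have "S = Y * Q"
      using S PQ by (simp add: Y_def assoc_mult_mat[of _ n n _ n _ n])
    ultimately have "S = 0\<^sub>m n n" using PQ by simp
    have "V * W = 1\<^sub>m n"
    proof (intro eq_matI)
      fix i j assume "i < dim_row (1\<^sub>m n :: complex mat)" "j < dim_col (1\<^sub>m n :: complex mat)"
      then have ij: "i < n" "j < n" by auto
      then have "S $$ (i, j) = 1\<^sub>m n $$ (i, j) - (V * W) $$ (i, j)"
        using carrier_matD[OF VW] unfolding S_def by (intro index_minus_mat(1)) auto
      then show "(V * W) $$ (i, j) = 1\<^sub>m n $$ (i, j)"
        using ij \<open>S = 0\<^sub>m n n\<close> by (simp del: index_mult_mat(1))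
    qed (use VW in auto)
    then show False
      using isometry_not_coisometry[OF V k] by (simp add: W_def)
  qed
  then obtain l where l: "l < n" "col Y l \<noteq> 0\<^sub>v n" "\<And>j. j < l \<Longrightarrow> col Y j = 0\<^sub>v n"
    using exists_least_iff[of "\<lambda>l. l < n \<and> col Y l \<noteq> 0\<^sub>v n"] by (metis order_less_trans)
  define x where "x = col Y l"
  have x: "x \<in> carrier_vec n" "x \<noteq> 0\<^sub>v n" using Y l by (auto simp: x_def)
  have Ax: "A *\<^sub>v x = B $$ (l, l) \<cdot>\<^sub>v x"
  proof (rule eq_vecI)
    fix i assume "i < dim_vec (B $$ (l, l) \<cdot>\<^sub>v x)"
    then have i: "i < n" using x by simp
    have "(A *\<^sub>v x) $ i = (A * Y) $$ (i, l)"
      using A Y i l by (simp add: x_def)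
    also have "\<dots> = (\<Sum>j<n. Y $$ (i, j) * B $$ (j, l))"
      using AY i l Y PQ by (simp add: index_mult_mat_sum[of _ n n _ n] del: index_mult_mat)
    also have "\<dots> = (\<Sum>j\<in>{l}. Y $$ (i, j) * B $$ (j, l))"
    proof (rule sum.mono_neutral_right)
      have "Y $$ (i, j) = 0" if "j < l" for j
        using arg_cong[OF l(3)[OF that], of "\<lambda>v. v $ i"] i Y l(1) that by simp
      moreover have "B $$ (j, l) = 0" if "l < j" "j < n" for j
        using B that PQ by (auto simp: upper_triangular_def)
      ultimately show "\<forall>j\<in>{..<n} - {l}. Y $$ (i, j) * B $$ (j, l) = 0"
        by (metis Diff_iff lessThan_iff linorder_neqE_nat mult_eq_0_iff singletonI)
    qed (use l in auto)
    finally show "(A *\<^sub>v x) $ i = (B $$ (l, l) \<cdot>\<^sub>v x) $ i"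
      using Y i l by (simp add: x_def)
  qed (use A x in auto)
  have Wx: "W *\<^sub>v x = 0\<^sub>v k"
  proof -
    have "x = Y *\<^sub>v unit_vec n l"
      using Y l by (intro eq_vecI) (auto simp: x_def)
    moreover have "W * Y = 0\<^sub>m k n"
      using W S PQ WS by (simp add: Y_def assoc_mult_mat[symmetric, of _ k n _ n _ n])
    moreover have "0\<^sub>m k n *\<^sub>v unit_vec n l = (0\<^sub>v k :: complex vec)"
      by (intro eq_vecI) auto
    ultimately show ?thesis
      using W Y by (simp add: assoc_mult_mat_vec[symmetric, of _ k n _ n])
  qed
  define u where "u = complex_of_real (1 / vnorm x) \<cdot>\<^sub>v x"
  have "vnorm x \<noteq> 0" using x by (simp add: vnorm_eq_0_iff)
  then have u1: "u \<bullet>c u = 1"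
    using x by (simp add: u_def conjugate_smult_vec cscalar_prod_self power2_eq_square)
  have u: "u \<in> carrier_vec n" using x by (simp add: u_def)
  have Au: "A *\<^sub>v u = B $$ (l, l) \<cdot>\<^sub>v u"
    using A x Ax by (simp add: u_def mult_mat_vec[of _ n n] smult_smult_assoc mult.commute)
  have Wu: "W *\<^sub>v u = 0\<^sub>v k"
    using W x Wx by (simp add: u_def mult_mat_vec[of _ k n]) (intro eq_vecI; simp)
  show ?thesis
    using hermitian_eigenvalue_real[OF A u u1 Au] u u1 Au Wu by (metis W_def)
qed

theorem spectral_decomposition_exists:
  assumes A: "A \<in> carrier_mat n n" "hermitian_mat A"
  obtains U d where "spectral_decomposition A U d"
proof -
  have "\<exists>V \<theta>. V \<in> carrier_mat n k \<and> mat_adjoint V * V = 1\<^sub>m k \<and>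
    A * V = V * mat_diag k (\<lambda>i. complex_of_real (\<theta> i))" if "k \<le> n" for k
    using that
  proof (induction k)
    case 0
    then show ?case
      using A by (intro exI[of _ "0\<^sub>m n 0"]) (auto simp: mat_eq_iff mat_diag_def)
  next
    case (Suc k)
    then obtain V \<theta> where V: "V \<in> carrier_mat n k" "mat_adjoint V * V = 1\<^sub>m k"
      and AV: "A * V = V * mat_diag k (\<lambda>i. complex_of_real (\<theta> i))" by auto
    obtain u \<mu> where u: "u \<in> carrier_vec n" "u \<bullet>c u = 1" "mat_adjoint V *\<^sub>v u = 0\<^sub>v k"
      "A *\<^sub>v u = complex_of_real \<mu> \<cdot>\<^sub>v u"
      using orthogonal_eigenvector_exists[OF A V AV] Suc.prems by auto
    define V' where "V' = Matrix.mat n (Suc k) (\<lambda>(i, j). if j < k then V $$ (i, j) else u $ i)"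
    have V': "V' \<in> carrier_mat n (Suc k)" by (simp add: V'_def)
    have V'_idx: "V' $$ (i, j) = (if j < k then V $$ (i, j) else u $ i)" if "i < n" "j < Suc k" for i j
      using that by (simp add: V'_def)
    have orth: "(\<Sum>r<n. cnj (V $$ (r, i)) * u $ r) = 0" if "i < k" for i
      using arg_cong[OF u(3), of "\<lambda>v. v $ i"] that V u(1)
      by (simp add: index_mult_mat_vec_sum[of _ k n] del: index_mult_mat_vec)
    then have orth': "(\<Sum>r<n. V $$ (r, i) * cnj (u $ r)) = 0" if "i < k" for i
      using arg_cong[OF orth[OF that], of cnj] by (simp add: mult.commute)
    have "mat_adjoint V' * V' = 1\<^sub>m (Suc k)"
    proof (rule eq_matI)
      fix i j assume "i < dim_row (1\<^sub>m (Suc k) :: complex mat)" "j < dim_col (1\<^sub>m (Suc k) :: complex mat)"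
      then have ij: "i < Suc k" "j < Suc k" by auto
      have "(mat_adjoint V' * V') $$ (i, j) = (\<Sum>r<n. cnj (V' $$ (r, i)) * V' $$ (r, j))"
        using V' ij by (simp add: index_mult_mat_sum[of _ "Suc k" n _ "Suc k"] del: index_mult_mat)
      also have "\<dots> = (if i = j then 1 else 0)"
      proof (cases "i < k \<and> j < k")
        case True
        then have "(\<Sum>r<n. cnj (V' $$ (r, i)) * V' $$ (r, j)) = (mat_adjoint V * V) $$ (i, j)"
          using V(1) ij by (simp add: index_mult_mat_sum[of _ k n _ k] V'_idx del: index_mult_mat)
        then show ?thesis unfolding V(2) using True by simp
      next
        case False
        then show ?thesis
          using ij orth orth' u(2) by (auto simp: V'_idx cscalar_prod_sum[OF u(1)] less_Suc_eq mult.commute)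
      qed
      finally show "(mat_adjoint V' * V') $$ (i, j) = 1\<^sub>m (Suc k) $$ (i, j)" using ij by simp
    qed (use V' in auto)
    moreover have "A * V' = V' * mat_diag (Suc k) (\<lambda>i. complex_of_real ((\<theta>(k := \<mu>)) i))"
    proof (rule eq_matI)
      fix i j
      assume "i < dim_row (V' * mat_diag (Suc k) (\<lambda>i. complex_of_real ((\<theta>(k := \<mu>)) i)))"
        "j < dim_col (V' * mat_diag (Suc k) (\<lambda>i. complex_of_real ((\<theta>(k := \<mu>)) i)))"
      then have ij: "i < n" "j < Suc k" using V' by (auto simp: mat_diag_def)
      have "(A * V') $$ (i, j) = (\<Sum>r<n. A $$ (i, r) * V' $$ (r, j))"
        using A V' ij by (simp add: index_mult_mat_sum[of _ n n _ "Suc k"] del: index_mult_mat)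
      also have "\<dots> = V' $$ (i, j) * complex_of_real ((\<theta>(k := \<mu>)) j)"
      proof (cases "j < k")
        case True
        then have "(\<Sum>r<n. A $$ (i, r) * V' $$ (r, j)) = (A * V) $$ (i, j)"
          using A V ij by (simp add: index_mult_mat_sum[of _ n n _ k] V'_idx del: index_mult_mat)
        also have "\<dots> = V $$ (i, j) * complex_of_real (\<theta> j)"
          using V ij True by (simp add: AV mat_diag_mult_right)
        finally show ?thesis using True ij by (simp add: V'_idx)
      next
        case False
        then have "(\<Sum>r<n. A $$ (i, r) * V' $$ (r, j)) = (A *\<^sub>v u) $ i"
          using A u(1) ij by (simp add: index_mult_mat_vec_sum[of _ n n] V'_idx del: index_mult_mat_vec)
        then show ?thesis using False ij u by (simp add: V'_idx)
      qed
      finally show "(A * V') $$ (i, j) =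
          (V' * mat_diag (Suc k) (\<lambda>i. complex_of_real ((\<theta>(k := \<mu>)) i))) $$ (i, j)"
        using V' ij by (simp add: mat_diag_mult_right)
    qed (use A V' in \<open>auto simp: mat_diag_def\<close>)
    ultimately show ?case using V' by blast
  qed
  from this[of n] obtain U d where U: "U \<in> carrier_mat n n" "mat_adjoint U * U = 1\<^sub>m n"
    and AU: "A * U = U * mat_diag n (\<lambda>i. complex_of_real (d i))" by auto
  have "U * mat_adjoint U = 1\<^sub>m n"
    using mat_mult_left_right_inverse[OF _ U(1) U(2)] U(1) by simp
  then have "A = A * U * mat_adjoint U"
    using A U by (simp add: assoc_mult_mat[of _ n n _ n _ n])
  then have "spectral_decomposition A U d"
    using A U AU by (simp add: spectral_decomposition_def)
  then show ?thesis by (rule that)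
qed

lemma spectral_decompositionD:
  assumes "spectral_decomposition A U d" "A \<in> carrier_mat n n"
  shows "U \<in> carrier_mat n n" "mat_adjoint U * U = 1\<^sub>m n" "U * mat_adjoint U = 1\<^sub>m n"
    "A = U * mat_diag n (\<lambda>i. complex_of_real (d i)) * mat_adjoint U"
proof -
  show U: "U \<in> carrier_mat n n" "mat_adjoint U * U = 1\<^sub>m n"
    "A = U * mat_diag n (\<lambda>i. complex_of_real (d i)) * mat_adjoint U"
    using assms by (auto simp: spectral_decomposition_def)
  show "U * mat_adjoint U = 1\<^sub>m n"
    using mat_mult_left_right_inverse[OF _ U(1) U(2)] U(1) by simp
qed

lemma mat_fun_eigenbasis:
  assumes U: "spectral_decomposition A U d" and A: "A \<in> carrier_mat n n" and x: "x \<in> carrier_vec n"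
    and i: "i < n"
  shows "(mat_adjoint U *\<^sub>v (mat_fun f A *\<^sub>v x)) $ i = complex_of_real (f (d i)) * (mat_adjoint U *\<^sub>v x) $ i"
proof -
  note U' = spectral_decompositionD[OF U A]
  define D where "D = mat_diag n (\<lambda>i. complex_of_real (f (d i)))"
  have D: "D \<in> carrier_mat n n" by (simp add: D_def)
  define W where "W = mat_adjoint U"
  have W: "W \<in> carrier_mat n n" using U' by (simp add: W_def)
  have "mat_fun f A = U * D * W"
    using mat_fun_eq[OF U] A by (simp add: D_def W_def)
  then have "W *\<^sub>v (mat_fun f A *\<^sub>v x) =
      (W * U) *\<^sub>v (D *\<^sub>v (W *\<^sub>v x))"
    using U'(1) W D x by (simp add: assoc_mult_mat_vec[of _ n n _ n])
  also have "\<dots> = D *\<^sub>v (W *\<^sub>v x)"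
    unfolding U'(2)[folded W_def] using D W x by (intro one_mult_mat_vec mult_mat_vec_carrier)
  finally have *: "W *\<^sub>v (mat_fun f A *\<^sub>v x) = D *\<^sub>v (W *\<^sub>v x)" .
  have "(D *\<^sub>v y) $ i = complex_of_real (f (d i)) * y $ i" if "y \<in> carrier_vec n" for y
  proof -
    have "(D *\<^sub>v y) $ i = (\<Sum>k<n. D $$ (i, k) * y $ k)"
      by (rule index_mult_mat_vec_sum[OF D that i])
    also have "\<dots> = (\<Sum>k<n. if i = k then complex_of_real (f (d i)) * y $ i else 0)"
      using i by (intro sum.cong) (auto simp: D_def mat_diag_def)
    finally show ?thesis using i by simp
  qed
  then show ?thesis
    unfolding W_def[symmetric] * using W x by (metis mult_mat_vec_carrier)
qed

lemma mat_eigenbasis: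
  assumes U: "spectral_decomposition A U d" and A: "A \<in> carrier_mat n n" and x: "x \<in> carrier_vec n"
    and i: "i < n"
  shows "(mat_adjoint U *\<^sub>v (A *\<^sub>v x)) $ i = complex_of_real (d i) * (mat_adjoint U *\<^sub>v x) $ i"
proof -
  have "mat_fun (\<lambda>x. x) A = A"
    using mat_fun_eq[OF U, of "\<lambda>x. x"] spectral_decompositionD(4)[OF U A] A by auto
  then show ?thesis using mat_fun_eigenbasis[OF assms, of "\<lambda>x. x"] by simp
qed

lemma eq_unitary_mult_vecI:
  assumes U: "U \<in> carrier_mat n n" "U * mat_adjoint U = 1\<^sub>m n" and x: "x \<in> carrier_vec n"
    and y: "y \<in> carrier_vec n" and eq: "\<And>i. i < n \<Longrightarrow> (mat_adjoint U *\<^sub>v x) $ i = y $ i"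
  shows "x = U *\<^sub>v y"
proof -
  have "mat_adjoint U *\<^sub>v x = y"
    using U(1) y eq by (intro eq_vecI) (auto simp del: index_mult_mat_vec)
  then have "U *\<^sub>v y = (U * mat_adjoint U) *\<^sub>v x"
    using U(1) x by (simp add: assoc_mult_mat_vec[of _ n n _ n])
  then show ?thesis using U x by simp
qed

section \<open>Eigenvalues and compressions\<close>

lemma spectral_eigenvector:
  assumes U: "spectral_decomposition A U d" and A: "A \<in> carrier_mat n n" and i: "i < n"
  obtains x where "x \<in> carrier_vec n" "x \<bullet>c x = 1" "A *\<^sub>v x = complex_of_real (d i) \<cdot>\<^sub>v x"
proof -
  note U' = spectral_decompositionD[OF U A]
  define x where "x = U *\<^sub>v unit_vec n i"
  have x: "x \<in> carrier_vec n" using U' by (simp add: x_def)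
  have Wx: "mat_adjoint U *\<^sub>v x = unit_vec n i"
    unfolding x_def using U'(1,2) by (subst assoc_mult_mat_vec[symmetric, of _ n n _ n]) auto
  have "A *\<^sub>v x = U *\<^sub>v (complex_of_real (d i) \<cdot>\<^sub>v unit_vec n i)"
  proof (rule eq_unitary_mult_vecI[OF U'(1,3)])
    fix k assume k: "k < n"
    show "(mat_adjoint U *\<^sub>v (A *\<^sub>v x)) $ k = (complex_of_real (d i) \<cdot>\<^sub>v unit_vec n i) $ k"
      unfolding mat_eigenbasis[OF U A x k] Wx using k i by simp
  qed (use A x in auto)
  also have "\<dots> = complex_of_real (d i) \<cdot>\<^sub>v x"
    using U' by (simp add: x_def mult_mat_vec[of _ n n])
  finally have "A *\<^sub>v x = complex_of_real (d i) \<cdot>\<^sub>v x" .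
  moreover have "x \<bullet>c x = 1"
    unfolding x_def using isometry_cscalar_prod[OF U'(1,2), of "unit_vec n i" "unit_vec n i"] i by simp
  ultimately show ?thesis using that x by blast
qed

lemma real_eigenvalues:
  assumes U: "spectral_decomposition A U d" and A: "A \<in> carrier_mat n n"
  shows "{x. eigenvalue A (complex_of_real x)} = d ` {..<n}"
proof (intro equalityI subsetI)
  fix x assume "x \<in> {x. eigenvalue A (complex_of_real x)}"
  then obtain v where v: "v \<in> carrier_vec n" "v \<noteq> 0\<^sub>v n" "A *\<^sub>v v = complex_of_real x \<cdot>\<^sub>v v"
    using A by (auto simp: eigenvalue_def eigenvector_def)
  note U' = spectral_decompositionD[OF U A]
  have "\<exists>i<n. (mat_adjoint U *\<^sub>v v) $ i \<noteq> 0"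
  proof (rule ccontr)
    assume "\<not> ?thesis"
    then have "v = U *\<^sub>v 0\<^sub>v n"
      using v U' by (intro eq_unitary_mult_vecI) (auto simp del: index_mult_mat_vec)
    moreover have "U *\<^sub>v 0\<^sub>v n = 0\<^sub>v n"
      using U'(1) by (intro eq_vecI) auto
    ultimately show False using v(2) by simp
  qed
  then obtain i where i: "i < n" "(mat_adjoint U *\<^sub>v v) $ i \<noteq> 0" by blast
  have "complex_of_real (d i) * (mat_adjoint U *\<^sub>v v) $ i = (mat_adjoint U *\<^sub>v (A *\<^sub>v v)) $ i"
    using mat_eigenbasis[OF U A v(1) i(1)] by simp
  also have "\<dots> = complex_of_real x * (mat_adjoint U *\<^sub>v v) $ i"
    using v(1) U'(1) i(1) by (simp add: v(3) mult_mat_vec[of _ n n])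
  finally have "d i = x" using i(2) by simp
  then show "x \<in> d ` {..<n}" using i by blast
next
  fix x assume "x \<in> d ` {..<n}"
  then obtain i where i: "i < n" "x = d i" by auto
  obtain v where v: "v \<in> carrier_vec n" "v \<bullet>c v = 1" "A *\<^sub>v v = complex_of_real (d i) \<cdot>\<^sub>v v"
    using spectral_eigenvector[OF U A i(1)] .
  then have "v \<noteq> 0\<^sub>v n" by auto
  then show "x \<in> {x. eigenvalue A (complex_of_real x)}"
    using v A i by (auto simp: eigenvalue_def eigenvector_def)
qed

lemma rayleigh_ge:
  assumes U: "spectral_decomposition A U d" and A: "A \<in> carrier_mat n n" and x: "x \<in> carrier_vec n"
    and l: "\<And>i. i < n \<Longrightarrow> l \<le> d i"
  shows "l * (vnorm x)\<^sup>2 \<le> Re ((A *\<^sub>v x) \<bullet>c x)"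
proof -
  note U' = spectral_decompositionD[OF U A]
  define W where "W = mat_adjoint U"
  have W: "W \<in> carrier_mat n n" "mat_adjoint W * W = 1\<^sub>m n" using U' by (simp_all add: W_def)
  have "(A *\<^sub>v x) \<bullet>c x = (W *\<^sub>v (A *\<^sub>v x)) \<bullet>c (W *\<^sub>v x)"
    using A x by (intro isometry_cscalar_prod[OF W, symmetric]) auto
  also have "\<dots> = (\<Sum>i<n. complex_of_real (d i) * (W *\<^sub>v x) $ i * cnj ((W *\<^sub>v x) $ i))"
    using W(1) x
    by (subst cscalar_prod_sum[of _ n]) (auto simp: W_def mat_eigenbasis[OF U A x] simp del: index_mult_mat_vec)
  also have "\<dots> = complex_of_real (\<Sum>i<n. d i * (cmod ((W *\<^sub>v x) $ i))\<^sup>2)"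
    by (simp add: complex_norm_square mult.assoc del: of_real_power)
  finally have *: "Re ((A *\<^sub>v x) \<bullet>c x) = (\<Sum>i<n. d i * (cmod ((W *\<^sub>v x) $ i))\<^sup>2)"
    by (simp only: Re_complex_of_real)
  have "(vnorm x)\<^sup>2 = (vnorm (W *\<^sub>v x))\<^sup>2"
    using isometry_vnorm[OF W x] by simp
  also have "\<dots> = (\<Sum>i<n. (cmod ((W *\<^sub>v x) $ i))\<^sup>2)"
    using W(1) by (simp add: vnorm_square_sum del: index_mult_mat_vec)
  finally have "l * (vnorm x)\<^sup>2 = (\<Sum>i<n. l * (cmod ((W *\<^sub>v x) $ i))\<^sup>2)"
    by (simp add: sum_distrib_left)
  also have "\<dots> \<le> Re ((A *\<^sub>v x) \<bullet>c x)"
    unfolding * using l by (intro sum_mono mult_right_mono) auto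
  finally show ?thesis .
qed

lemma compression_carrier:
  assumes "A \<in> carrier_mat n n" "V \<in> carrier_mat n m"
  shows "mat_adjoint V * A \<in> carrier_mat m n" "mat_adjoint V * A * V \<in> carrier_mat m m"
proof -
  show VA: "mat_adjoint V * A \<in> carrier_mat m n"
    using assms by (intro mult_carrier_mat) auto
  show "mat_adjoint V * A * V \<in> carrier_mat m m"
    using VA assms(2) by (rule mult_carrier_mat)
qed

lemma compression_hermitian:
  assumes A: "A \<in> carrier_mat n n" "hermitian_mat A" and V: "V \<in> carrier_mat n m"
  shows "hermitian_mat (mat_adjoint V * A * V)"
proof -
  have "mat_adjoint (mat_adjoint V * A * V) = mat_adjoint V * mat_adjoint (mat_adjoint V * A)"
    using compression_carrier(1)[OF A(1) V] V by (rule mat_adjoint_mult)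
  also have "mat_adjoint (mat_adjoint V * A) = mat_adjoint A * V"
    using A V by (subst mat_adjoint_mult[of _ m n _ n]) auto
  also have "mat_adjoint V * (mat_adjoint A * V) = mat_adjoint V * A * V"
    using A V by (simp add: hermitian_mat_def assoc_mult_mat[of _ m n _ n _ m])
  finally show ?thesis by (simp add: hermitian_mat_def)
qed

text \<open>A unit eigenvector \<open>x\<close> of \<open>V\<^sup>* A V\<close> for the eigenvalue \<open>\<theta>\<^sub>k\<close> gives the Rayleigh quotient
  \<open>\<theta>\<^sub>k\<close> of \<open>A\<close> at the unit vector \<open>V x\<close>.\<close>

lemma compression_eigenvalue_ge:
  assumes U: "spectral_decomposition A U d" and A: "A \<in> carrier_mat n n"
    and l: "\<And>i. i < n \<Longrightarrow> l \<le> d i"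
    and V: "V \<in> carrier_mat n m" "mat_adjoint V * V = 1\<^sub>m m"
    and Q: "spectral_decomposition (mat_adjoint V * A * V) Q \<theta>" and k: "k < m"
  shows "l \<le> \<theta> k"
proof -
  define T where "T = mat_adjoint V * A * V"
  have T: "T \<in> carrier_mat m m" unfolding T_def using A V(1) by (rule compression_carrier)
  obtain x where x: "x \<in> carrier_vec m" "x \<bullet>c x = 1" "T *\<^sub>v x = complex_of_real (\<theta> k) \<cdot>\<^sub>v x"
    using spectral_eigenvector[OF Q[folded T_def] T k] .
  have Vx: "V *\<^sub>v x \<in> carrier_vec n" using V x by simp
  have "complex_of_real (\<theta> k) = (T *\<^sub>v x) \<bullet>c x"
    using x by simp
  also have "T *\<^sub>v x = mat_adjoint V *\<^sub>v (A *\<^sub>v (V *\<^sub>v x))"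
  proof -
    show ?thesis
      unfolding T_def using compression_carrier(1)[OF A V(1)] V(1) A x(1) Vx
      by (simp add: assoc_mult_mat_vec[of "mat_adjoint V * A" m n V m] assoc_mult_mat_vec[of _ m n A n])
  qed
  also have "\<dots> \<bullet>c x = (A *\<^sub>v (V *\<^sub>v x)) \<bullet>c (V *\<^sub>v x)"
    using V(1) A x(1) Vx by (subst cscalar_prod_mult_mat_vec[of _ m n]) auto
  finally have "\<theta> k = Re ((A *\<^sub>v (V *\<^sub>v x)) \<bullet>c (V *\<^sub>v x))"
    by (metis Re_complex_of_real)
  moreover have "(vnorm (V *\<^sub>v x))\<^sup>2 = 1"
    using isometry_vnorm[OF V x(1)] x(2) by (metis cscalar_prod_self of_real_eq_1_iff)
  ultimately show ?thesis
    using rayleigh_ge[OF U A Vx l] by simp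
qed

section \<open>Orthogonal polynomials of a discrete measure\<close>

text \<open>The index is shifted as in the Lanczos process, so \<open>jacobi_poly \<alpha> \<beta> j\<close> has degree \<open>j - 1\<close>.
  If \<open>\<beta>\<close> vanishes at \<open>j + 2\<close>, the convention \<open>1 / 0 = 0\<close> makes the next polynomial zero, which
  matches the zero vector that then follows in the Lanczos process.\<close>

fun jacobi_poly :: "(nat \<Rightarrow> real) \<Rightarrow> (nat \<Rightarrow> real) \<Rightarrow> nat \<Rightarrow> real poly" where
  "jacobi_poly \<alpha> \<beta> 0 = 0"
| "jacobi_poly \<alpha> \<beta> (Suc 0) = 1"
| "jacobi_poly \<alpha> \<beta> (Suc (Suc j)) = Polynomial.smult (1 / \<beta> (Suc (Suc j)))
     (pCons 0 (jacobi_poly \<alpha> \<beta> (Suc j)) - Polynomial.smult (\<alpha> (Suc j)) (jacobi_poly \<alpha> \<beta> (Suc j))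
        - Polynomial.smult (\<beta> (Suc j)) (jacobi_poly \<alpha> \<beta> j))"

text \<open>The counterpart of \<open>w\<^sub>j\<close>: the next polynomial before normalisation. Unlike that polynomial it
  keeps its degree when the norm \<open>\<beta>\<^sub>j\<^sub>+\<^sub>1\<close> is zero, so that no case distinction on \<open>\<beta>\<^sub>m\<^sub>+\<^sub>1\<close> is
  necessary below.\<close>

definition jacobi_residual :: "(nat \<Rightarrow> real) \<Rightarrow> (nat \<Rightarrow> real) \<Rightarrow> nat \<Rightarrow> real poly" where
  "jacobi_residual \<alpha> \<beta> j = pCons 0 (jacobi_poly \<alpha> \<beta> j) - Polynomial.smult (\<alpha> j) (jacobi_poly \<alpha> \<beta> j)
     - Polynomial.smult (\<beta> j) (jacobi_poly \<alpha> \<beta> (j - 1))"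

lemma jacobi_poly_step:
  assumes "1 \<le> j"
  shows "jacobi_poly \<alpha> \<beta> (Suc j) = Polynomial.smult (1 / \<beta> (Suc j)) (jacobi_residual \<alpha> \<beta> j)"
  using assms by (cases j) (simp_all add: jacobi_residual_def)

lemma jacobi_degree:
  assumes "1 \<le> j" and "\<And>i. 2 \<le> i \<Longrightarrow> i \<le> j \<Longrightarrow> \<beta> i \<noteq> 0"
  shows "jacobi_poly \<alpha> \<beta> j \<noteq> 0 \<and> degree (jacobi_poly \<alpha> \<beta> j) = j - 1"
    and "jacobi_residual \<alpha> \<beta> j \<noteq> 0 \<and> degree (jacobi_residual \<alpha> \<beta> j) = j"
proof -
  have res: "jacobi_residual \<alpha> \<beta> i \<noteq> 0 \<and> degree (jacobi_residual \<alpha> \<beta> i) = i"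
    if "1 \<le> i" "jacobi_poly \<alpha> \<beta> i \<noteq> 0" "degree (jacobi_poly \<alpha> \<beta> i) = i - 1"
      "degree (jacobi_poly \<alpha> \<beta> (i - 1)) < i" for i
  proof -
    define q where "q = Polynomial.smult (\<alpha> i) (jacobi_poly \<alpha> \<beta> i) + Polynomial.smult (\<beta> i) (jacobi_poly \<alpha> \<beta> (i - 1))"
    have "degree q < i"
      using that unfolding q_def
      by (intro degree_add_less) (auto intro: le_less_trans[OF degree_smult_le])
    moreover have "degree (pCons 0 (jacobi_poly \<alpha> \<beta> i)) = i"
      using that by (simp add: degree_pCons_eq)
    moreover have "jacobi_residual \<alpha> \<beta> i = pCons 0 (jacobi_poly \<alpha> \<beta> i) + - q"
      by (simp add: jacobi_residual_def q_def)
    ultimately have "degree (jacobi_residual \<alpha> \<beta> i) = i"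
      using degree_add_eq_left[of "- q" "pCons 0 (jacobi_poly \<alpha> \<beta> i)"] by (metis degree_minus)
    then show ?thesis using that(1) by auto
  qed
  have deg: "jacobi_poly \<alpha> \<beta> i \<noteq> 0 \<and> degree (jacobi_poly \<alpha> \<beta> i) = i - 1"
    if "1 \<le> i" "i \<le> j" for i
    using that
  proof (induction i rule: less_induct)
    case (less i)
    show ?case
    proof (cases "i = 1")
      case False
      define k where "k = i - 1"
      have k: "i = Suc k" "1 \<le> k" "k < i" using False less.prems by (auto simp: k_def)
      have "degree (jacobi_poly \<alpha> \<beta> (k - 1)) < k"
        using less.IH[of "k - 1"] less.prems k by (cases "k = 1") auto
      then have "jacobi_residual \<alpha> \<beta> k \<noteq> 0 \<and> degree (jacobi_residual \<alpha> \<beta> k) = k"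
        using less.IH[of k] less.prems k by (intro res) auto
      then show ?thesis
        using assms(2)[of i] less.prems k by (simp add: jacobi_poly_step)
    qed simp
  qed
  show "jacobi_poly \<alpha> \<beta> j \<noteq> 0 \<and> degree (jacobi_poly \<alpha> \<beta> j) = j - 1"
    using deg assms by blast
  moreover have "degree (jacobi_poly \<alpha> \<beta> (j - 1)) < j"
    using deg[of "j - 1"] assms(1) by (cases "j = 1") auto
  ultimately show "jacobi_residual \<alpha> \<beta> j \<noteq> 0 \<and> degree (jacobi_residual \<alpha> \<beta> j) = j"
    using assms(1) by (intro res) auto
qed

locale discrete_inner =
  fixes n :: nat and \<omega> d :: "nat \<Rightarrow> real"
  assumes weight_nonneg: "\<And>i. i < n \<Longrightarrow> 0 \<le> \<omega> i"
begin

definition ip :: "(real \<Rightarrow> real) \<Rightarrow> (real \<Rightarrow> real) \<Rightarrow> real" where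
  "ip g h = (\<Sum>i<n. \<omega> i * g (d i) * h (d i))"

lemma ip_commute: "ip g h = ip h g"
  by (simp add: ip_def mult_ac)

lemma ip_self_nonneg: "0 \<le> ip g g"
  unfolding ip_def by (intro sum_nonneg) (simp add: weight_nonneg mult.assoc)

lemma ip_diff_left: "ip (\<lambda>x. g x - g' x) h = ip g h - ip g' h"
  by (simp add: ip_def algebra_simps sum_subtractf)

lemma ip_poly_zero [simp]: "ip (poly 0) h = 0" "ip h (poly 0) = 0"
  by (simp_all add: ip_def)

lemma ip_poly_add: "ip (poly (p + q)) h = ip (poly p) h + ip (poly q) h"
  by (simp add: ip_def algebra_simps sum.distrib)

lemma ip_poly_diff: "ip (poly (p - q)) h = ip (poly p) h - ip (poly q) h"
  by (simp add: ip_def algebra_simps sum_subtractf)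

lemma ip_poly_smult: "ip (poly (Polynomial.smult c p)) h = c * ip (poly p) h"
  by (simp add: ip_def algebra_simps sum_distrib_left)

lemma ip_poly_smult_right: "ip h (poly (Polynomial.smult c p)) = c * ip h (poly p)"
  by (simp add: ip_def algebra_simps sum_distrib_left)

lemma ip_poly_sum: "ip (poly (\<Sum>j\<in>J. p j)) h = (\<Sum>j\<in>J. ip (poly (p j)) h)"
  unfolding ip_def by (subst sum.swap) (simp add: poly_sum sum_distrib_left sum_distrib_right)

lemma ip_poly_shift: "ip (poly (pCons 0 p)) (poly q) = ip (poly p) (poly (pCons 0 q))"
  by (simp add: ip_def mult_ac)

lemma ip_cauchy_schwarz: "\<bar>ip g h\<bar> \<le> sqrt (ip g g) * sqrt (ip h h)"
proof -
  have "\<omega> i * a * b = (sqrt (\<omega> i) * a) * (sqrt (\<omega> i) * b)" if "i < n" for i a b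
  proof -
    have "(sqrt (\<omega> i) * a) * (sqrt (\<omega> i) * b) = (sqrt (\<omega> i) * sqrt (\<omega> i)) * a * b"
      by (simp only: mult_ac)
    then show ?thesis using weight_nonneg[OF that] by simp
  qed
  then have "\<bar>ip g h\<bar> = \<bar>\<Sum>i<n. (sqrt (\<omega> i) * g (d i)) * (sqrt (\<omega> i) * h (d i))\<bar>"
    unfolding ip_def by (intro arg_cong[of _ _ abs] sum.cong refl) simp
  also have "\<dots> \<le> (\<Sum>i<n. \<bar>sqrt (\<omega> i) * g (d i)\<bar> * \<bar>sqrt (\<omega> i) * h (d i)\<bar>)"
    by (rule order_trans[OF sum_abs]) (simp add: abs_mult)
  also have "\<dots> \<le> L2_set (\<lambda>i. sqrt (\<omega> i) * g (d i)) {..<n} * L2_set (\<lambda>i. sqrt (\<omega> i) * h (d i)) {..<n}"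
    by (rule L2_set_mult_ineq)
  also have "\<dots> = sqrt (ip g g) * sqrt (ip h h)"
  proof -
    have "L2_set (\<lambda>i. sqrt (\<omega> i) * g (d i)) {..<n} = sqrt (ip g g)" for g
      unfolding L2_set_def ip_def
      by (intro arg_cong[of _ _ sqrt] sum.cong refl)
        (simp add: weight_nonneg power_mult_distrib power2_eq_square mult.assoc)
    then show ?thesis by simp
  qed
  finally show ?thesis .
qed

end

text \<open>The conditions on \<open>\<alpha>\<close> and \<open>\<beta>\<close> say that they arise from the first \<open>m\<close> steps of the Lanczos
  process (the Stieltjes procedure) for the discrete measure, with no breakdown before step
  \<open>m\<close>; the process may break down in step \<open>m\<close>.\<close>

locale lanczos_polynomials = discrete_inner +
  fixes \<alpha> \<beta> :: "nat \<Rightarrow> real" and m :: nat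
  assumes m_pos: "1 \<le> m"
    and ip_one: "ip (\<lambda>_. 1) (\<lambda>_. 1) = 1"
    and alpha: "\<And>j. 1 \<le> j \<Longrightarrow> j \<le> m \<Longrightarrow> \<alpha> j =
      ip (poly (pCons 0 (jacobi_poly \<alpha> \<beta> j) - Polynomial.smult (\<beta> j) (jacobi_poly \<alpha> \<beta> (j - 1))))
         (poly (jacobi_poly \<alpha> \<beta> j))"
    and beta_nonneg: "\<And>j. 0 \<le> \<beta> j"
    and beta: "\<And>j. 1 \<le> j \<Longrightarrow> j \<le> m \<Longrightarrow> (\<beta> (Suc j))\<^sup>2 =
      ip (poly (jacobi_residual \<alpha> \<beta> j)) (poly (jacobi_residual \<alpha> \<beta> j))"
    and beta_nonzero: "\<And>j. 2 \<le> j \<Longrightarrow> j \<le> m \<Longrightarrow> \<beta> j \<noteq> 0"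
begin

abbreviation "P \<equiv> jacobi_poly \<alpha> \<beta>"
abbreviation "R \<equiv> jacobi_residual \<alpha> \<beta>"

lemma degree_P: "1 \<le> j \<Longrightarrow> j \<le> m \<Longrightarrow> degree (P j) = j - 1"
  using jacobi_degree(1)[of j \<beta> \<alpha>] beta_nonzero by auto

lemma degree_R: "degree (R m) = m"
  using jacobi_degree(2)[OF m_pos] beta_nonzero by auto

lemma R_eq: "1 \<le> j \<Longrightarrow> j < m \<Longrightarrow> R j = Polynomial.smult (\<beta> (Suc j)) (P (Suc j))"
  using beta_nonzero[of "Suc j"] by (simp add: jacobi_poly_step)

lemma shift_P: "pCons 0 (P j) = R j + Polynomial.smult (\<alpha> j) (P j) + Polynomial.smult (\<beta> j) (P (j - 1))"
  by (simp add: jacobi_residual_def)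

text \<open>The reason why three terms suffice: multiplication by \<open>x\<close> is self-adjoint, so the inner product
  of \<open>x P\<^sub>k\<close> with \<open>P\<^sub>j\<close> is that of \<open>P\<^sub>k\<close> with \<open>x P\<^sub>j\<close>. The latter is a combination of \<open>P\<^sub>j\<^sub>-\<^sub>1\<close>,
  \<open>P\<^sub>j\<close> and \<open>P\<^sub>j\<^sub>+\<^sub>1\<close> and so contributes only for \<open>j \<ge> k - 1\<close>; these contributions are what the
  recurrence subtracts.\<close>

lemma residual_orthogonal_step:
  assumes k: "1 \<le> k" "k \<le> m" and j: "1 \<le> j" "j \<le> k"
    and orth: "\<And>i j. 1 \<le> i \<Longrightarrow> i \<le> k \<Longrightarrow> 1 \<le> j \<Longrightarrow> j \<le> k \<Longrightarrow>
      ip (poly (P i)) (poly (P j)) = (if i = j then 1 else 0)"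
  shows "ip (poly (R k)) (poly (P j)) = 0"
proof (cases "j = k")
  case True
  have "ip (poly (R k)) (poly (P k)) =
      ip (poly (pCons 0 (P k) - Polynomial.smult (\<beta> k) (P (k - 1)))) (poly (P k)) - \<alpha> k * ip (poly (P k)) (poly (P k))"
    by (simp add: jacobi_residual_def ip_poly_diff ip_poly_smult)
  then show ?thesis
    using True alpha[of k] k orth[of k k] by simp
next
  case False
  then have jk: "j < k" using j by simp
  have low: "ip (poly (P (j - 1))) (poly (P k)) = 0"
    using orth[of "j - 1" k] jk j by (cases "j = 1") auto
  have "ip (poly (pCons 0 (P k))) (poly (P j)) = ip (poly (pCons 0 (P j))) (poly (P k))"
    by (subst ip_poly_shift) (rule ip_commute)
  also have "\<dots> = \<beta> (Suc j) * ip (poly (P (Suc j))) (poly (P k))"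
    using R_eq[of j] j jk k orth[of j k] low
    by (subst shift_P) (simp add: ip_poly_add ip_poly_smult)
  also have "\<dots> = \<beta> k * ip (poly (P (k - 1))) (poly (P j))"
    using orth[of "Suc j" k] orth[of "k - 1" j] j jk k by auto
  finally show ?thesis
    using orth[of k j] j jk k
    by (simp add: jacobi_residual_def ip_poly_diff ip_poly_smult)
qed

lemma P_orthonormal:
  assumes "1 \<le> i" "i \<le> m" "1 \<le> j" "j \<le> m"
  shows "ip (poly (P i)) (poly (P j)) = (if i = j then 1 else 0)"
proof -
  have "1 \<le> k \<Longrightarrow> k \<le> m \<Longrightarrow> \<forall>i j. 1 \<le> i \<longrightarrow> i \<le> k \<longrightarrow> 1 \<le> j \<longrightarrow> j \<le> k \<longrightarrow>
      ip (poly (P i)) (poly (P j)) = (if i = j then 1 else 0)" for k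
  proof (induction k)
    case (Suc k)
    show ?case
    proof (cases "k = 0")
      case True
      then show ?thesis using ip_one by (auto simp: le_Suc_eq)
    next
      case False
      then have IH: "\<And>i j. 1 \<le> i \<Longrightarrow> i \<le> k \<Longrightarrow> 1 \<le> j \<Longrightarrow> j \<le> k \<Longrightarrow>
          ip (poly (P i)) (poly (P j)) = (if i = j then 1 else 0)"
        using Suc by simp
      have \<beta>: "\<beta> (Suc k) \<noteq> 0" using beta_nonzero[of "Suc k"] Suc.prems False by simp
      have Pk: "P (Suc k) = Polynomial.smult (1 / \<beta> (Suc k)) (R k)"
        using False by (simp add: jacobi_poly_step)
      have new: "ip (poly (P (Suc k))) (poly (P j)) = 0" if "1 \<le> j" "j \<le> k" for j
        using residual_orthogonal_step[OF _ _ that IH] that Suc.prems by (simp add: Pk ip_poly_smult)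
      have "ip (poly (P (Suc k))) (poly (P (Suc k))) = 1"
        using beta[of k, symmetric] False Suc.prems \<beta>
        by (simp add: Pk ip_poly_smult ip_poly_smult_right power2_eq_square)
      moreover have "ip (poly (P j)) (poly (P (Suc k))) = 0" if "1 \<le> j" "j \<le> k" for j
        using new[OF that] by (subst ip_commute)
      ultimately show ?thesis
        using new IH by (auto simp: le_Suc_eq)
    qed
  qed simp
  then show ?thesis using assms m_pos by blast
qed

lemma R_orthogonal: "1 \<le> j \<Longrightarrow> j \<le> m \<Longrightarrow> ip (poly (R m)) (poly (P j)) = 0"
  using residual_orthogonal_step[of m j] m_pos P_orthonormal by auto

text \<open>The \<open>P\<^sub>j\<close> have degrees \<open>0, \<dots>, m - 1\<close>, so subtracting multiples of them lowers the degree of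
  \<open>q\<close> step by step until nothing is left.\<close>

lemma orthogonal_to_low_degree:
  assumes orth: "\<And>j. 1 \<le> j \<Longrightarrow> j \<le> m \<Longrightarrow> ip g (poly (P j)) = 0" and q: "degree q < m"
  shows "ip g (poly q) = 0"
proof -
  have "k \<le> m \<Longrightarrow> q = 0 \<or> degree q < k \<Longrightarrow> ip g (poly q) = 0" for k
  proof (induction k arbitrary: q)
    case (Suc k)
    define c where "c = coeff q k / coeff (P (Suc k)) k"
    define q' where "q' = q - Polynomial.smult c (P (Suc k))"
    have deg: "degree (P (Suc k)) = k" using degree_P[of "Suc k"] Suc.prems by simp
    have "P (Suc k) \<noteq> 0" using P_orthonormal[of "Suc k" "Suc k"] Suc.prems by auto
    then have "coeff (P (Suc k)) k \<noteq> 0" using deg by (metis leading_coeff_0_iff)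
    then have "coeff q' k = 0" by (simp add: q'_def c_def)
    moreover have "degree q' \<le> k"
      unfolding q'_def using Suc.prems deg by (intro degree_diff_le) auto
    ultimately have "q' = 0 \<or> degree q' < k"
      by (metis le_neq_implies_less leading_coeff_0_iff)
    then have "ip g (poly q') = 0" using Suc by simp
    moreover have "ip (poly q) g = ip (poly q') g + c * ip (poly (P (Suc k))) g"
      by (simp only: q'_def ip_poly_diff ip_poly_smult diff_add_cancel)
    ultimately show ?case
      using orth[of "Suc k"] Suc.prems by (simp add: ip_commute[of g])
  qed simp
  then show ?thesis using q by blast
qed

text \<open>The orthogonal projection of \<open>g\<close>, in its Fourier expansion with respect to the \<open>P\<^sub>j\<close>.\<close>

definition best_approx :: "(real \<Rightarrow> real) \<Rightarrow> real poly" where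
  "best_approx g = (\<Sum>j=1..m. Polynomial.smult (ip g (poly (P j))) (P j))"

lemma degree_best_approx: "degree (best_approx g) \<le> m - 1"
  unfolding best_approx_def using degree_P
  by (intro degree_sum_le) (auto intro!: order_trans[OF degree_smult_le])

lemma best_approx_orthogonal:
  assumes "degree q \<le> m - 1"
  shows "ip (\<lambda>x. g x - poly (best_approx g) x) (poly q) = 0"
proof (rule orthogonal_to_low_degree)
  fix j assume j: "1 \<le> j" "j \<le> m"
  have "ip (poly (best_approx g)) (poly (P j)) =
      (\<Sum>i=1..m. ip g (poly (P i)) * (if i = j then 1 else 0))"
    using j by (auto simp: best_approx_def ip_poly_sum ip_poly_smult P_orthonormal intro!: sum.cong)
  also have "\<dots> = ip g (poly (P j))" using j by (simp add: if_distrib[of "(*) _"] cong: if_cong)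
  finally show "ip (\<lambda>x. g x - poly (best_approx g) x) (poly (P j)) = 0"
    by (simp add: ip_diff_left)
qed (use assms m_pos in simp)

lemma best_approx_minimal:
  assumes "degree q \<le> m - 1"
  shows "ip (\<lambda>x. g x - poly (best_approx g) x) (\<lambda>x. g x - poly (best_approx g) x)
    \<le> ip (\<lambda>x. g x - poly q x) (\<lambda>x. g x - poly q x)"
proof -
  define e where "e = (\<lambda>x. g x - poly (best_approx g) x)"
  define r where "r = best_approx g - q"
  have "degree r \<le> m - 1"
    unfolding r_def using degree_best_approx assms by (intro degree_diff_le)
  then have "ip e (poly r) = 0" unfolding e_def by (rule best_approx_orthogonal)
  moreover have "(\<lambda>x. g x - poly q x) = (\<lambda>x. e x + poly r x)"
    by (simp add: e_def r_def)
  moreover have "ip (\<lambda>x. e x + poly r x) (\<lambda>x. e x + poly r x) =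
      ip e e + 2 * ip e (poly r) + ip (poly r) (poly r)"
    by (simp add: ip_def algebra_simps sum.distrib sum_distrib_left)
  ultimately show ?thesis
    using ip_self_nonneg[of "poly r"] unfolding e_def by simp
qed

text \<open>The residual has norm \<open>\<beta>\<^sub>m\<^sub>+\<^sub>1\<close> and does not see the best approximation, so the bound
  is the Cauchy--Schwarz inequality for \<open>R\<close> and the approximation error.\<close>

lemma residual_coefficient_le:
  "\<bar>ip (poly (R m)) g\<bar> \<le> \<beta> (Suc m) *
     sqrt (ip (\<lambda>x. g x - poly (best_approx g) x) (\<lambda>x. g x - poly (best_approx g) x))"
proof -
  have "ip (poly (best_approx g)) (poly (R m)) = 0"
    using degree_best_approx[of g] m_pos
    by (subst ip_commute) (rule orthogonal_to_low_degree[OF R_orthogonal], auto)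
  then have "ip (poly (R m)) g = ip (poly (R m)) (\<lambda>x. g x - poly (best_approx g) x)"
    by (simp add: ip_commute[of "poly (R m)"] ip_diff_left)
  moreover have "sqrt (ip (poly (R m)) (poly (R m))) = \<beta> (Suc m)"
    using beta[of m] m_pos beta_nonneg by (simp flip: beta)
  ultimately show ?thesis
    using ip_cauchy_schwarz[of "poly (R m)"] by metis
qed

text \<open>The residual is orthogonal to \<open>P\<^sub>m\<close> and \<open>P\<^sub>m\<^sub>-\<^sub>1\<close>, hence is the orthogonal projection of
  \<open>x P\<^sub>m\<close>, and multiplication by \<open>x\<close> increases norms at most by the factor \<open>L\<close>.\<close>

lemma beta_le:
  assumes "\<And>i. i < n \<Longrightarrow> \<bar>d i\<bar> \<le> L" and "0 \<le> L"
  shows "\<beta> (Suc m) \<le> L"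
proof -
  have "(\<beta> (Suc m))\<^sup>2 = ip (poly (R m)) (poly (R m))"
    using beta[of m] m_pos by simp
  also have "\<dots> = ip (poly (pCons 0 (P m))) (poly (R m))"
  proof -
    have "ip (poly (P m)) (poly (R m)) = 0" "ip (poly (P (m - 1))) (poly (R m)) = 0"
      using R_orthogonal[of m] R_orthogonal[of "m - 1"] m_pos
      by (subst ip_commute; cases "m = 1"; simp)+
    then show ?thesis
      by (subst jacobi_residual_def) (simp add: ip_poly_diff ip_poly_smult)
  qed
  also have "\<dots> \<le> sqrt (ip (poly (pCons 0 (P m))) (poly (pCons 0 (P m)))) * sqrt (ip (poly (R m)) (poly (R m)))"
    using ip_cauchy_schwarz[of "poly (pCons 0 (P m))" "poly (R m)"] by linarith
  also have "sqrt (ip (poly (R m)) (poly (R m))) = \<beta> (Suc m)"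
    using beta[of m] m_pos beta_nonneg by (simp flip: beta)
  also have "sqrt (ip (poly (pCons 0 (P m))) (poly (pCons 0 (P m)))) \<le> L"
  proof (rule real_le_lsqrt)
    have "ip (poly (pCons 0 (P m))) (poly (pCons 0 (P m))) = (\<Sum>i<n. (d i)\<^sup>2 * (\<omega> i * (poly (P m) (d i))\<^sup>2))"
      by (simp add: ip_def power2_eq_square mult_ac)
    also have "\<dots> \<le> (\<Sum>i<n. L\<^sup>2 * (\<omega> i * (poly (P m) (d i))\<^sup>2))"
      using assms weight_nonneg by (intro sum_mono mult_right_mono) (auto simp: abs_le_square_iff[symmetric])
    also have "\<dots> = L\<^sup>2 * ip (poly (P m)) (poly (P m))"
      by (simp add: ip_def power2_eq_square sum_distrib_left mult_ac)
    finally show "ip (poly (pCons 0 (P m))) (poly (pCons 0 (P m))) \<le> L\<^sup>2"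
      using P_orthonormal[of m m] m_pos by simp
  qed (use assms in auto)
  finally have "\<beta> (Suc m) * \<beta> (Suc m) \<le> L * \<beta> (Suc m)"
    using beta_nonneg by (simp add: power2_eq_square mult_right_mono)
  then show ?thesis
    using beta_nonneg[of "Suc m"] assms(2) by (cases "\<beta> (Suc m) = 0") auto
qed

text \<open>The inner products of \<open>x P\<^sub>j\<close> with the \<open>P\<^sub>k\<close> are the entries of \<open>T\<^sub>m\<close>. The sum is the inner
  product of \<open>h\<close> with the projection of \<open>x P\<^sub>j\<close> to degree below \<open>m\<close>, and this projection changes
  \<open>x P\<^sub>j\<close> only for \<open>j = m\<close>, where it removes \<open>R\<^sub>m\<close>.\<close>

lemma compressed_shift:
  assumes j: "1 \<le> j" "j \<le> m"
  shows "(\<Sum>k=1..m. ip (poly (pCons 0 (P j))) (poly (P k)) * ip (poly (P k)) h) =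
    ip (poly (pCons 0 (P j))) h - (if j = m then ip (poly (R m)) h else 0)"
proof -
  define E where "E q = (\<Sum>k=1..m. ip (poly q) (poly (P k)) * ip (poly (P k)) h)" for q
  have E_add: "E (p + q) = E p + E q" and E_smult: "E (Polynomial.smult c p) = c * E p" for p q c
    by (simp_all add: E_def ip_poly_add ip_poly_smult algebra_simps sum.distrib sum_distrib_left)
  have E_P: "E (P i) = ip (poly (P i)) h" if "i \<le> m" for i
  proof (cases "i = 0")
    case False
    then have "E (P i) = (\<Sum>k=1..m. (if i = k then 1 else 0) * ip (poly (P k)) h)"
      using that by (auto simp: E_def P_orthonormal intro!: sum.cong)
    then show ?thesis using that False by (simp add: if_distrib[of "\<lambda>x. x * _"] cong: if_cong)
  qed (simp add: E_def)
  have E_R: "E (R j) = ip (poly (R j)) h - (if j = m then ip (poly (R m)) h else 0)"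
  proof (cases "j = m")
    case True
    then show ?thesis by (simp add: E_def R_orthogonal)
  next
    case False
    then show ?thesis using j R_eq[of j] by (simp add: E_smult E_P ip_poly_smult)
  qed
  have "E (pCons 0 (P j)) = ip (poly (pCons 0 (P j))) h - (if j = m then ip (poly (R m)) h else 0)"
    using j by (subst (1 2) shift_P) (simp add: E_add E_smult E_P E_R ip_poly_add ip_poly_smult)
  then show ?thesis by (simp add: E_def)
qed

text \<open>Dividing \<open>R\<^sub>m\<close> by \<open>x + t\<close> with remainder gives \<open>R\<^sub>m(x) = R\<^sub>m(- t) + (x + t) q(x)\<close> with
  \<open>deg q < m\<close>. The inner product of \<open>R\<^sub>m\<close> with \<open>R\<^sub>m(x) / (x + t)\<close> therefore loses the term with \<open>q\<close>
  by orthogonality.\<close>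

lemma residual_resolvent:
  assumes pos: "\<And>i. i < n \<Longrightarrow> 0 < d i" and t: "0 \<le> t"
  shows "poly (R m) (- t) * ip (poly (R m)) (\<lambda>x. 1 / (x + t)) =
    (\<Sum>i<n. \<omega> i * (poly (R m) (d i))\<^sup>2 / (d i + t))"
proof -
  define r where "r = poly (R m) (- t)"
  have "poly (R m - [:r:]) (- t) = 0" by (simp add: r_def)
  then obtain q where q: "R m - [:r:] = [:t, 1:] * q"
    by (metis dvdE minus_minus poly_eq_0_iff_dvd)
  have "degree q < m"
  proof (cases "q = 0")
    case False
    then have "degree ([:t, 1:] * q) = Suc (degree q)"
      by (subst degree_mult_eq) auto
    moreover have "degree (R m - [:r:]) \<le> m"
      using degree_R by (intro degree_diff_le) auto
    ultimately show ?thesis by (simp add: q)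
  qed (use m_pos in simp)
  then have "ip (poly (R m)) (poly q) = 0"
    by (intro orthogonal_to_low_degree[OF R_orthogonal])
  moreover have "poly q (d i) = poly (R m) (d i) / (d i + t) - r / (d i + t)" if "i < n" for i
  proof -
    have "poly (R m) (d i) - r = (d i + t) * poly q (d i)"
      using arg_cong[OF q, of "\<lambda>p. poly p (d i)"] by (simp add: algebra_simps)
    moreover have "d i + t \<noteq> 0" using pos[OF that] t by simp
    ultimately show ?thesis by (simp add: eq_divide_eq mult.commute flip: diff_divide_distrib)
  qed
  ultimately have "(\<Sum>i<n. \<omega> i * poly (R m) (d i) * (poly (R m) (d i) / (d i + t) - r / (d i + t))) = 0"
    by (simp add: ip_def)
  then show ?thesis
    by (simp add: ip_def right_diff_distrib sum_subtractf sum_distrib_left power2_eq_square mult_ac flip: r_def)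
qed

text \<open>Unless \<open>R\<^sub>m\<close> vanishes on the support of the measure, the right-hand side of
  \<open>residual_resolvent\<close> is positive. So the continuous function \<open>t \<mapsto> R\<^sub>m(- t)\<close> has no zero on
  \<open>[0,\<infinity>)\<close> and keeps its sign there, and so does the other factor.\<close>

lemma residual_resolvent_one_signed:
  assumes pos: "\<And>i. i < n \<Longrightarrow> 0 < d i"
  shows "(\<forall>t\<ge>0. 0 \<le> ip (poly (R m)) (\<lambda>x. 1 / (x + t))) \<or>
    (\<forall>t\<ge>0. ip (poly (R m)) (\<lambda>x. 1 / (x + t)) \<le> 0)"
proof (cases "\<exists>i<n. \<omega> i * poly (R m) (d i) \<noteq> 0")
  case False
  then have "ip (poly (R m)) h = 0" for h
    unfolding ip_def by (intro sum.neutral) auto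
  then show ?thesis by simp
next
  case True
  define g where "g t = ip (poly (R m)) (\<lambda>x. 1 / (x + t))" for t
  have Rg: "0 < poly (R m) (- t) * g t" if t: "0 \<le> t" for t
  proof -
    obtain i where i: "i < n" "\<omega> i * poly (R m) (d i) \<noteq> 0" using True by blast
    have "0 < (\<Sum>i<n. \<omega> i * (poly (R m) (d i))\<^sup>2 / (d i + t))"
    proof (rule sum_pos2[of _ i])
      show "0 < \<omega> i * (poly (R m) (d i))\<^sup>2 / (d i + t)"
        using i weight_nonneg[of i] pos[of i] t by (simp add: less_le add_nonneg_eq_0_iff)
      show "0 \<le> \<omega> k * (poly (R m) (d k))\<^sup>2 / (d k + t)" if "k \<in> {..<n}" for k
        using that weight_nonneg[of k] pos[of k] t by simp
    qed (use i in auto)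
    then show ?thesis using residual_resolvent[OF pos t] by (simp add: g_def)
  qed
  have "connected ((\<lambda>t. poly (R m) (- t)) ` {0..})"
    by (intro connected_continuous_image continuous_intros) (simp add: convex_connected)
  then have ivt: "x \<in> (\<lambda>t. poly (R m) (- t)) ` {0..}"
    if "0 \<le> s" "0 \<le> t" "poly (R m) (- s) \<le> x" "x \<le> poly (R m) (- t)" for s t x
    using that unfolding connected_iff_interval by (meson atLeast_iff imageI)
  have "(\<forall>t\<ge>0. 0 < poly (R m) (- t)) \<or> (\<forall>t\<ge>0. poly (R m) (- t) < 0)"
  proof (rule ccontr)
    assume "\<not> ?thesis"
    then obtain s t where "0 \<le> s" "0 \<le> t" "poly (R m) (- s) \<le> 0" "0 \<le> poly (R m) (- t)"
      by (auto simp: not_less)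
    then obtain r where "0 \<le> r" "poly (R m) (- r) = 0"
      using ivt[of s t 0] by auto
    then show False using Rg[of r] by simp
  qed
  then show ?thesis
  proof
    assume "\<forall>t\<ge>0. 0 < poly (R m) (- t)"
    then have "0 < g t" if "0 \<le> t" for t using Rg[OF that] that zero_less_mult_pos by blast
    then show ?thesis by (auto simp: g_def intro: less_imp_le)
  next
    assume "\<forall>t\<ge>0. poly (R m) (- t) < 0"
    then have "g t < 0" if "0 \<le> t" for t using Rg[OF that] that by (auto simp: zero_less_mult_iff)
    then show ?thesis by (auto simp: g_def intro: less_imp_le)
  qed
qed

end

section \<open>Integrals of resolvents\<close>

text \<open>Restricting \<open>d\<mu>\<close> to \<open>[0,\<infinity>)\<close> turns the set integrals into plain ones. Integrability at
  one point \<open>z = 1\<close> gives it at every \<open>z > 0\<close>, since \<open>(1 + t) / (z + t)\<close> is bounded.\<close>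

lemma stieltjes_function_integral:
  assumes "stieltjes_function f"
  obtains N :: "real measure"
  where "\<And>t. t \<in> space N \<Longrightarrow> 0 \<le> t"
    and "\<And>z. 0 < z \<Longrightarrow> integrable N (\<lambda>t. 1 / (z + t))"
    and "\<And>z. 0 < z \<Longrightarrow> f z = (\<integral>t. 1 / (z + t) \<partial>N)"
proof -
  obtain \<mu> where int: "set_integrable (stieltjes_measure \<mu>) {0..} (\<lambda>t. 1 / (1 + t))"
    and f: "\<And>z. z > 0 \<Longrightarrow> f z = (LINT t:{0..}|stieltjes_measure \<mu>. 1 / (z + t))"
    using assms by (auto simp: stieltjes_function_def)
  define N where "N = restrict_space (stieltjes_measure \<mu>) {0..}"
  have sets: "sets (stieltjes_measure \<mu>) = sets borel"
    by (simp add: stieltjes_measure_def)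
  then have atLeast: "{0..} \<inter> space (stieltjes_measure \<mu>) \<in> sets (stieltjes_measure \<mu>)"
    by (auto simp: sets_eq_imp_space_eq[OF sets])
  have space: "t \<in> space N \<Longrightarrow> 0 \<le> t" for t
    by (simp add: N_def space_restrict_space)
  have int1: "integrable N (\<lambda>t. 1 / (1 + t))"
    using int atLeast by (simp add: N_def integrable_restrict_space set_integrable_def)
  have "integrable N (\<lambda>t. 1 / (z + t))" if z: "0 < z" for z
  proof (rule Bochner_Integration.integrable_bound)
    define c where "c = max 1 (1 / z)"
    show "integrable N (\<lambda>t. c * (1 / (1 + t)))"
      using int1 by (rule integrable_mult_right)
    have "(\<lambda>t. 1 / (z + t)) \<in> borel_measurable (stieltjes_measure \<mu>)"
      unfolding measurable_cong_sets[OF sets refl] by measurable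
    then show "(\<lambda>t. 1 / (z + t)) \<in> borel_measurable N"
      unfolding N_def by (rule measurable_restrict_space1)
    have "1 / (z + t) \<le> c * (1 / (1 + t))" if t: "0 \<le> t" for t
    proof -
      have "1 \<le> c" "1 \<le> c * z" using z by (auto simp: c_def max_def field_simps)
      then have "1 + t \<le> c * (z + t)"
        using t mult_right_mono[of 1 c t] by (simp add: distrib_left)
      then show ?thesis using z t by (simp add: field_simps)
    qed
    moreover have "0 \<le> c" by (simp add: c_def)
    ultimately show "AE t in N. norm (1 / (z + t)) \<le> norm (c * (1 / (1 + t)))"
      using z space by (intro AE_I2) simp
  qed
  moreover have "f z = (\<integral>t. 1 / (z + t) \<partial>N)" if "0 < z" for z
    using atLeast that by (simp add: f N_def integral_restrict_space set_lebesgue_integral_def)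
  ultimately show ?thesis using that space by blast
qed

text \<open>The absolute value of the integral of \<open>g\<close>, and not just the integral of \<open>\<bar>g\<bar>\<close>, controls the
  weighted integral, because the two agree for a function of one sign.\<close>

lemma one_signed_weighted_integral:
  fixes g h :: "real \<Rightarrow> real"
  assumes g: "integrable N g" and h: "h \<in> borel_measurable N"
    and bound: "\<And>t. t \<in> space N \<Longrightarrow> \<bar>h t\<bar> \<le> c"
    and sign: "(\<forall>t\<in>space N. 0 \<le> g t) \<or> (\<forall>t\<in>space N. g t \<le> 0)"
  shows "integrable N (\<lambda>t. h t * g t)" and "\<bar>\<integral>t. h t * g t \<partial>N\<bar> \<le> c * \<bar>\<integral>t. g t \<partial>N\<bar>"
proof -
  have le: "\<bar>h t * g t\<bar> \<le> c * \<bar>g t\<bar>" if "t \<in> space N" for t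
    using bound[OF that] by (simp add: abs_mult mult_right_mono)
  have cg: "integrable N (\<lambda>t. c * \<bar>g t\<bar>)"
    using g by (intro integrable_mult_right integrable_abs)
  show int: "integrable N (\<lambda>t. h t * g t)"
  proof (rule Bochner_Integration.integrable_bound[OF cg])
    show "(\<lambda>t. h t * g t) \<in> borel_measurable N"
      using g h by (intro borel_measurable_times) auto
    show "AE t in N. norm (h t * g t) \<le> norm (c * \<bar>g t\<bar>)"
      using le by (intro AE_I2) (force intro: order_trans)
  qed
  have abs_int: "(\<integral>t. \<bar>g t\<bar> \<partial>N) = \<bar>\<integral>t. g t \<partial>N\<bar>"
    using sign
  proof
    assume "\<forall>t\<in>space N. 0 \<le> g t"
    then have "(\<integral>t. \<bar>g t\<bar> \<partial>N) = (\<integral>t. g t \<partial>N)" "0 \<le> (\<integral>t. g t \<partial>N)"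
      by (auto intro!: Bochner_Integration.integral_cong Bochner_Integration.integral_nonneg_AE AE_I2)
    then show ?thesis by simp
  next
    assume *: "\<forall>t\<in>space N. g t \<le> 0"
    then have "(\<integral>t. \<bar>g t\<bar> \<partial>N) = (\<integral>t. - g t \<partial>N)"
      by (intro Bochner_Integration.integral_cong) auto
    moreover have "0 \<le> (\<integral>t. - g t \<partial>N)"
      using * by (intro Bochner_Integration.integral_nonneg_AE AE_I2) auto
    ultimately show ?thesis by simp
  qed
  have "\<bar>\<integral>t. h t * g t \<partial>N\<bar> \<le> (\<integral>t. \<bar>h t * g t\<bar> \<partial>N)"
    by (rule integral_abs_bound)
  also have "\<dots> \<le> (\<integral>t. c * \<bar>g t\<bar> \<partial>N)"
    using int cg le by (intro integral_mono) auto
  also have "\<dots> = c * \<bar>\<integral>t. g t \<partial>N\<bar>"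
    by (simp add: abs_int)
  finally show "\<bar>\<integral>t. h t * g t \<partial>N\<bar> \<le> c * \<bar>\<integral>t. g t \<partial>N\<bar>" .
qed

text \<open>By \<open>eq\<close>, \<open>y(t) = (T + t)\<^sup>-\<^sup>1 v - g(t) (T + t)\<^sup>-\<^sup>1 w\<close>. The first term integrates to \<open>f(T) v\<close>. The
  second is estimated in an eigenbasis of \<open>T\<close>, where it is a scalar integral for each eigenvalue
  with the weight \<open>1 / (\<theta>\<^sub>k + t) \<le> 1 / l\<close>.\<close>

theorem perturbed_resolvent_integral:
  fixes y :: "real \<Rightarrow> complex vec" and g :: "real \<Rightarrow> real"
  assumes N_nonneg: "\<And>t. t \<in> space N \<Longrightarrow> 0 \<le> t"
    and N_int: "\<And>z. 0 < z \<Longrightarrow> integrable N (\<lambda>t. 1 / (z + t))"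
    and f: "\<And>z. 0 < z \<Longrightarrow> f z = (\<integral>t. 1 / (z + t) \<partial>N)"
    and T: "T \<in> carrier_mat m m" "spectral_decomposition T Q \<theta>"
    and l: "0 < l" "\<And>k. k < m \<Longrightarrow> l \<le> \<theta> k"
    and v: "v \<in> carrier_vec m" and w: "w \<in> carrier_vec m"
    and g: "integrable N g" "(\<forall>t\<in>space N. 0 \<le> g t) \<or> (\<forall>t\<in>space N. g t \<le> 0)"
    and y: "\<And>t. y t \<in> carrier_vec m" "\<And>j. j < m \<Longrightarrow> integrable N (\<lambda>t. y t $ j)"
    and u: "u \<in> carrier_vec m" "\<And>j. j < m \<Longrightarrow> u $ j = (\<integral>t. y t $ j \<partial>N)"
    and eq: "\<And>t. t \<in> space N \<Longrightarrow>
      T *\<^sub>v y t + complex_of_real t \<cdot>\<^sub>v y t = v - complex_of_real (g t) \<cdot>\<^sub>v w"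
  shows "vnorm (u - mat_fun f T *\<^sub>v v) \<le> (1 / l) * \<bar>\<integral>t. g t \<partial>N\<bar> * vnorm w"
proof -
  define q where "q = mat_adjoint Q"
  note Q = spectral_decompositionD[OF T(2,1)]
  have q: "q \<in> carrier_mat m m" using Q by (simp add: q_def)
  have q_iso: "mat_adjoint q * q = 1\<^sub>m m" using Q by (simp add: q_def)
  have fT: "mat_fun f T *\<^sub>v v \<in> carrier_vec m"
    using mat_fun_eq[OF T(2)] T(1) Q v by (intro mult_mat_vec_carrier) auto
  have "cmod ((q *\<^sub>v (u - mat_fun f T *\<^sub>v v)) $ k) \<le> ((1 / l) * \<bar>\<integral>t. g t \<partial>N\<bar>) * cmod ((q *\<^sub>v w) $ k)"
    if k: "k < m" for k
  proof -
    define h where "h t = 1 / (\<theta> k + t)" for t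
    have \<theta>: "0 < \<theta> k" using l k by force
    have h_le: "\<bar>h t\<bar> \<le> 1 / l" if "t \<in> space N" for t
      using N_nonneg[OF that] l k \<theta> by (force simp: h_def intro!: divide_left_mono mult_pos_pos add_pos_nonneg add_increasing2)
    have h_int: "integrable N h" unfolding h_def[abs_def] using \<theta> by (rule N_int)
    note hg = one_signed_weighted_integral[OF g(1) borel_measurable_integrable[OF h_int] h_le g(2)]
    have comp: "(q *\<^sub>v y t) $ k = (q *\<^sub>v v) $ k * of_real (h t) - (q *\<^sub>v w) $ k * of_real (h t * g t)"
      if t: "t \<in> space N" for t
    proof -
      have "(q *\<^sub>v (T *\<^sub>v y t + complex_of_real t \<cdot>\<^sub>v y t)) $ k
          = (q *\<^sub>v (v - complex_of_real (g t) \<cdot>\<^sub>v w)) $ k"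
        by (simp only: eq[OF t])
      moreover have "(q *\<^sub>v (T *\<^sub>v y t + complex_of_real t \<cdot>\<^sub>v y t)) $ k
          = (q *\<^sub>v (T *\<^sub>v y t)) $ k + of_real t * (q *\<^sub>v y t) $ k"
        using q T(1) y(1)[of t] k
        by (simp add: mult_add_distrib_mat_vec[of _ m m] mult_mat_vec[of _ m m])
      moreover have "(q *\<^sub>v (v - complex_of_real (g t) \<cdot>\<^sub>v w)) $ k
          = (q *\<^sub>v v) $ k - of_real (g t) * (q *\<^sub>v w) $ k"
        using q v w k by (simp add: mult_minus_distrib_mat_vec[of _ m m] mult_mat_vec[of _ m m])
      moreover have "(q *\<^sub>v (T *\<^sub>v y t)) $ k = of_real (\<theta> k) * (q *\<^sub>v y t) $ k"
        unfolding q_def by (rule mat_eigenbasis[OF T(2,1) y(1) k])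
      ultimately have "of_real (\<theta> k + t) * (q *\<^sub>v y t) $ k = (q *\<^sub>v v) $ k - of_real (g t) * (q *\<^sub>v w) $ k"
        by (simp add: distrib_right)
      moreover have "complex_of_real (\<theta> k + t) \<noteq> 0"
        using \<theta> N_nonneg[OF t] by (simp del: of_real_add)
      ultimately have "(q *\<^sub>v y t) $ k = ((q *\<^sub>v v) $ k - of_real (g t) * (q *\<^sub>v w) $ k) / of_real (\<theta> k + t)"
        by (simp add: eq_divide_eq mult.commute del: of_real_add)
      then show ?thesis
        by (simp add: h_def diff_divide_distrib mult.commute)
    qed
    have "(q *\<^sub>v u) $ k = (\<Sum>j<m. q $$ (k, j) * (\<integral>t. y t $ j \<partial>N))"
      using q u k by (subst index_mult_mat_vec_sum[of _ m m]) auto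
    also have "\<dots> = (\<integral>t. (\<Sum>j<m. q $$ (k, j) * y t $ j) \<partial>N)"
      using y(2) by (simp add: integral_sum)
    also have "\<dots> = (\<integral>t. (q *\<^sub>v y t) $ k \<partial>N)"
      using q y(1) k by (simp only: index_mult_mat_vec_sum[of q m m])
    also have "\<dots> = (\<integral>t. (q *\<^sub>v v) $ k * of_real (h t) - (q *\<^sub>v w) $ k * of_real (h t * g t) \<partial>N)"
      by (intro Bochner_Integration.integral_cong refl comp)
    also have "\<dots> = (\<integral>t. (q *\<^sub>v v) $ k * of_real (h t) \<partial>N) - (\<integral>t. (q *\<^sub>v w) $ k * of_real (h t * g t) \<partial>N)"
      using h_int hg(1)
      by (intro Bochner_Integration.integral_diff integrable_mult_right integrable_of_real) auto
    also have "\<dots> = (q *\<^sub>v v) $ k * of_real (\<integral>t. h t \<partial>N) - (q *\<^sub>v w) $ k * of_real (\<integral>t. h t * g t \<partial>N)"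
      by (simp only: integral_mult_right_zero integral_complex_of_real)
    also have "(\<integral>t. h t \<partial>N) = f (\<theta> k)"
      using f[OF \<theta>] by (simp add: h_def)
    finally have qu: "(q *\<^sub>v u) $ k = (q *\<^sub>v v) $ k * of_real (f (\<theta> k)) - (q *\<^sub>v w) $ k * of_real (\<integral>t. h t * g t \<partial>N)" .
    have "(q *\<^sub>v (u - mat_fun f T *\<^sub>v v)) $ k = (q *\<^sub>v u) $ k - (q *\<^sub>v (mat_fun f T *\<^sub>v v)) $ k"
      using q u(1) fT k by (simp add: mult_minus_distrib_mat_vec[of _ m m])
    also have "(q *\<^sub>v (mat_fun f T *\<^sub>v v)) $ k = of_real (f (\<theta> k)) * (q *\<^sub>v v) $ k"
      unfolding q_def by (rule mat_fun_eigenbasis[OF T(2,1) v k])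
    finally have "(q *\<^sub>v (u - mat_fun f T *\<^sub>v v)) $ k = - ((q *\<^sub>v w) $ k * of_real (\<integral>t. h t * g t \<partial>N))"
      by (simp add: qu mult.commute)
    then have "cmod ((q *\<^sub>v (u - mat_fun f T *\<^sub>v v)) $ k) = \<bar>\<integral>t. h t * g t \<partial>N\<bar> * cmod ((q *\<^sub>v w) $ k)"
      by (simp add: norm_mult mult.commute)
    then show ?thesis
      using mult_right_mono[OF hg(2), of "cmod ((q *\<^sub>v w) $ k)"] by simp
  qed
  then have "vnorm (q *\<^sub>v (u - mat_fun f T *\<^sub>v v)) \<le> ((1 / l) * \<bar>\<integral>t. g t \<partial>N\<bar>) * vnorm (q *\<^sub>v w)"
    using l q u fT w by (intro vnorm_le_by_entries[of _ m]) auto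
  then show ?thesis
    using isometry_vnorm[OF q q_iso] u(1) fT w by simp
qed

section \<open>Spectral coordinates of a vector\<close>

locale spectral_coordinates =
  fixes A U :: "complex mat" and d :: "nat \<Rightarrow> real" and b :: "complex vec" and n :: nat
  assumes A: "A \<in> carrier_mat n n" and U: "spectral_decomposition A U d"
    and b: "b \<in> carrier_vec n"
begin

definition c :: "complex vec" where "c = mat_adjoint U *\<^sub>v b"

definition \<omega> :: "nat \<Rightarrow> real" where "\<omega> i = (cmod (c $ i))\<^sup>2"

text \<open>This is \<open>g(A) b\<close>: it agrees with the matrix functions and with polynomials in \<open>A\<close> by
  \<open>mat_fun_F\<close> and \<open>poly_mat_F\<close>. Complex values of \<open>g\<close> are necessary because the competing
  polynomials are complex.\<close>

definition F :: "(real \<Rightarrow> complex) \<Rightarrow> complex vec" where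
  "F g = U *\<^sub>v Matrix.vec n (\<lambda>i. g (d i) * c $ i)"

abbreviation Fr :: "(real \<Rightarrow> real) \<Rightarrow> complex vec" where
  "Fr g \<equiv> F (\<lambda>x. complex_of_real (g x))"

sublocale discrete_inner n \<omega> d
  by unfold_locales (simp add: \<omega>_def)

lemmas U' = spectral_decompositionD[OF U A]

lemma F_carrier [simp]: "F g \<in> carrier_vec n"
  using U'(1) by (simp add: F_def)

lemma dim_F [simp]: "dim_vec (F g) = n"
  using F_carrier by (rule carrier_vecD)

lemma F_coordinate: "i < n \<Longrightarrow> (mat_adjoint U *\<^sub>v F g) $ i = g (d i) * c $ i"
  using U'(1,2) unfolding F_def
  by (subst assoc_mult_mat_vec[symmetric, of _ n n _ n]) (auto simp del: index_mult_mat_vec)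

lemma F_eqI:
  assumes "x \<in> carrier_vec n" and "\<And>i. i < n \<Longrightarrow> (mat_adjoint U *\<^sub>v x) $ i = g (d i) * c $ i"
  shows "x = F g"
  unfolding F_def using assms U' by (intro eq_unitary_mult_vecI) auto

lemma F_one: "F (\<lambda>_. 1) = b"
  by (rule sym, rule F_eqI[OF b]) (simp add: c_def del: index_mult_mat_vec)

lemma F_index: "i < n \<Longrightarrow> F g $ i = (\<Sum>r<n. U $$ (i, r) * (g (d r) * c $ r))"
  unfolding F_def using U'(1) by (subst index_mult_mat_vec_sum) auto

lemma F_diff: "F g - F h = F (\<lambda>x. g x - h x)"
  by (intro eq_vecI) (simp_all add: F_index algebra_simps sum_subtractf)

lemma F_smult: "k \<cdot>\<^sub>v F g = F (\<lambda>x. k * g x)"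
  by (intro eq_vecI) (simp_all add: F_index algebra_simps sum_distrib_left)

lemma F_add: "F g + F h = F (\<lambda>x. g x + h x)"
  by (intro eq_vecI) (simp_all add: F_index algebra_simps sum.distrib)

lemma F_zero: "F (\<lambda>_. 0) = 0\<^sub>v n"
  by (intro eq_vecI) (simp_all add: F_index)

lemma mult_F: "A *\<^sub>v F g = F (\<lambda>x. complex_of_real x * g x)"
  using A by (intro F_eqI mult_mat_vec_carrier[OF A F_carrier])
    (simp add: mat_eigenbasis[OF U A] F_coordinate del: index_mult_mat_vec)

lemma pow_mult_F: "(A ^\<^sub>m k) *\<^sub>v F g = F (\<lambda>x. complex_of_real x ^ k * g x)"
proof (induction k arbitrary: g)
  case 0
  then show ?case using A by simp
next
  case (Suc k)
  have "(A ^\<^sub>m Suc k) *\<^sub>v F g = (A ^\<^sub>m k) *\<^sub>v (A *\<^sub>v F g)"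
    using A by (simp add: assoc_mult_mat_vec[of _ n n _ n])
  then show ?case by (simp add: mult_F Suc mult_ac)
qed

lemma pow_F: "(A ^\<^sub>m k) *\<^sub>v b = Fr (\<lambda>x. x ^ k)"
  using pow_mult_F[of k "\<lambda>_. 1"] by (simp add: F_one)

lemma mat_fun_F: "mat_fun f A *\<^sub>v b = Fr f"
proof (rule F_eqI)
  show "mat_fun f A *\<^sub>v b \<in> carrier_vec n"
    using mat_fun_eq[OF U] A U'(1) b by (intro mult_mat_vec_carrier) auto
qed (simp add: mat_fun_eigenbasis[OF U A b] c_def del: index_mult_mat_vec)

lemma poly_mat_F: "poly_mat q A *\<^sub>v b = F (\<lambda>x. poly q (complex_of_real x))"
proof (rule eq_vecI)
  fix i assume "i < dim_vec (F (\<lambda>x. poly q (complex_of_real x)))"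
  then have i: "i < n" by simp
  have "poly_mat q A \<in> carrier_mat n n"
    using A by (auto simp: poly_mat_def)
  then have "(poly_mat q A *\<^sub>v b) $ i = (\<Sum>j<n. (\<Sum>k\<le>degree q. coeff q k * (A ^\<^sub>m k) $$ (i, j)) * b $ j)"
    using A b i by (subst index_mult_mat_vec_sum[of _ n n]) (auto simp: poly_mat_def)
  also have "\<dots> = (\<Sum>k\<le>degree q. coeff q k * (\<Sum>j<n. (A ^\<^sub>m k) $$ (i, j) * b $ j))"
    by (simp add: sum_distrib_right sum_distrib_left mult.assoc, subst sum.swap, rule refl)
  also have "\<dots> = (\<Sum>k\<le>degree q. coeff q k * Fr (\<lambda>x. x ^ k) $ i)"
    using A b i by (simp only: pow_F[symmetric]) (simp add: index_mult_mat_vec_sum[of _ n n] del: index_mult_mat_vec)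
  also have "\<dots> = (\<Sum>r<n. U $$ (i, r) * (poly q (complex_of_real (d r)) * c $ r))"
    by (simp add: F_index[OF i] poly_altdef sum_distrib_left sum_distrib_right mult_ac,
        subst sum.swap, rule refl)
  finally show "(poly_mat q A *\<^sub>v b) $ i = F (\<lambda>x. poly q (complex_of_real x)) $ i"
    by (simp add: F_index[OF i])
qed (use A in \<open>simp add: poly_mat_def\<close>)

lemma F_inner: "F g \<bullet>c F h = (\<Sum>i<n. complex_of_real (\<omega> i) * g (d i) * cnj (h (d i)))"
proof -
  have "F g \<bullet>c F h = Matrix.vec n (\<lambda>i. g (d i) * c $ i) \<bullet>c Matrix.vec n (\<lambda>i. h (d i) * c $ i)"
    unfolding F_def using U' by (intro isometry_cscalar_prod) auto
  also have "\<dots> = (\<Sum>i<n. complex_of_real (\<omega> i) * g (d i) * cnj (h (d i)))"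
    by (subst cscalar_prod_sum[of _ n])
      (auto simp: \<omega>_def complex_norm_square mult_ac simp del: of_real_power intro!: sum.cong)
  finally show ?thesis .
qed

lemma Fr_inner: "Fr g \<bullet>c Fr h = complex_of_real (ip g h)"
  by (simp add: F_inner ip_def)

lemma vnorm_F: "(vnorm (F g))\<^sup>2 = (\<Sum>i<n. \<omega> i * (cmod (g (d i)))\<^sup>2)"
proof -
  have "complex_of_real ((vnorm (F g))\<^sup>2) = complex_of_real (\<Sum>i<n. \<omega> i * (cmod (g (d i)))\<^sup>2)"
    unfolding cscalar_prod_self[symmetric] F_inner
    by (simp add: complex_norm_square mult.assoc del: of_real_power)
  then show ?thesis by (simp only: of_real_eq_iff)
qed

lemma vnorm_Fr: "vnorm (Fr g) = sqrt (ip g g)"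
proof -
  have "(vnorm (Fr g))\<^sup>2 = (\<Sum>i<n. \<omega> i * (g (d i))\<^sup>2)"
    by (simp add: vnorm_F)
  then have "(vnorm (Fr g))\<^sup>2 = ip g g"
    by (simp add: ip_def power2_eq_square mult.assoc)
  then show ?thesis by (metis real_sqrt_unique vnorm_nonneg)
qed

text \<open>Taking real parts of the coefficients takes the real part of the values at the real nodes, and
  this brings them closer to the real number \<open>g(d\<^sub>i)\<close>. So complex polynomials approximate a real
  function no better than real ones.\<close>

lemma vnorm_Fr_sub_poly:
  assumes "degree q \<le> k"
  obtains q' where "degree q' \<le> k"
    and "sqrt (ip (\<lambda>x. g x - poly q' x) (\<lambda>x. g x - poly q' x)) \<le> vnorm (Fr g - F (\<lambda>x. poly q (complex_of_real x)))"
proof -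
  define q' where "q' = map_poly Re q"
  have Re_poly: "poly q' x = Re (poly q (complex_of_real x))" for x
    unfolding q'_def by (induction q) (simp_all add: map_poly_pCons)
  have "ip (\<lambda>x. g x - poly q' x) (\<lambda>x. g x - poly q' x)
      \<le> (vnorm (Fr g - F (\<lambda>x. poly q (complex_of_real x))))\<^sup>2"
    unfolding F_diff vnorm_F ip_def
  proof (rule sum_mono)
    fix i assume "i \<in> {..<n}"
    define z where "z = complex_of_real (g (d i)) - poly q (complex_of_real (d i))"
    have "(g (d i) - poly q' (d i))\<^sup>2 = (Re z)\<^sup>2" by (simp add: z_def Re_poly)
    also have "\<dots> \<le> (cmod z)\<^sup>2" by (simp add: cmod_power2)
    finally show "\<omega> i * (g (d i) - poly q' (d i)) * (g (d i) - poly q' (d i)) \<le> \<omega> i * (cmod z)\<^sup>2"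
      by (simp add: \<omega>_def mult_left_mono power2_eq_square mult.assoc)
  qed
  moreover have "degree q' \<le> k"
    unfolding q'_def using degree_map_poly_le[of Re q] assms by linarith
  ultimately show ?thesis
    using that by (metis real_sqrt_le_mono real_sqrt_unique vnorm_nonneg)
qed

section \<open>The Lanczos vectors as orthogonal polynomials\<close>

text \<open>The number computed by the process is complex by type. Only its real part is kept here, so
  that the recurrence has real coefficients; \<open>lanczos_w_eq\<close> shows that nothing is lost.\<close>

definition \<alpha> :: "nat \<Rightarrow> real" where
  "\<alpha> j = Re ((A *\<^sub>v lanczos_v A b j - complex_of_real (lanczos_beta A b j) \<cdot>\<^sub>v lanczos_v A b (j - 1))
     \<bullet>c lanczos_v A b j)"

abbreviation "\<beta> \<equiv> lanczos_beta A b"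
abbreviation "P \<equiv> jacobi_poly \<alpha> \<beta>"
abbreviation "R \<equiv> jacobi_residual \<alpha> \<beta>"

lemma lanczos_w_eq:
  assumes "1 \<le> j" and v: "lanczos_v A b j = Fr (poly (P j))" "lanczos_v A b (j - 1) = Fr (poly (P (j - 1)))"
  shows "lanczos_w A b j = Fr (poly (R j))"
    and "\<alpha> j = ip (poly (pCons 0 (P j) - Polynomial.smult (\<beta> j) (P (j - 1)))) (poly (P j))"
proof -
  have w: "A *\<^sub>v lanczos_v A b j - complex_of_real (\<beta> j) \<cdot>\<^sub>v lanczos_v A b (j - 1)
      = Fr (poly (pCons 0 (P j) - Polynomial.smult (\<beta> j) (P (j - 1))))"
    unfolding v mult_F F_smult F_diff by (rule arg_cong[of _ _ F]) (simp add: fun_eq_iff)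
  show \<alpha>: "\<alpha> j = ip (poly (pCons 0 (P j) - Polynomial.smult (\<beta> j) (P (j - 1)))) (poly (P j))"
    by (simp only: \<alpha>_def w) (simp only: v(1) Fr_inner Re_complex_of_real)
  obtain i where j: "j = Suc i" using assms(1) by (cases j) auto
  have "lanczos_w A b j = Fr (poly (pCons 0 (P j) - Polynomial.smult (\<beta> j) (P (j - 1))))
      - complex_of_real (\<alpha> j) \<cdot>\<^sub>v Fr (poly (P j))"
    using w v by (simp only: j lanczos_w.simps Let_def diff_Suc_1 \<alpha>[unfolded j] Fr_inner)
  also have "\<dots> = Fr (poly (R j))"
    unfolding F_smult F_diff by (rule arg_cong[of _ _ F]) (simp add: jacobi_residual_def fun_eq_iff algebra_simps)
  finally show "lanczos_w A b j = Fr (poly (R j))" .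
qed

lemma lanczos_v_eq: "lanczos_v A b j = Fr (poly (P j))"
proof (induction j rule: less_induct)
  case (less j)
  consider "j = 0" | "j = 1" | i where "j = Suc (Suc i)" by (metis One_nat_def not0_implies_Suc)
  then show ?case
  proof cases
    case 1
    then show ?thesis using b F_zero by simp
  next
    case 2
    then show ?thesis using F_one by simp
  next
    case 3
    have w: "lanczos_w A b (Suc i) = Fr (poly (R (Suc i)))"
      using less 3 by (intro lanczos_w_eq) auto
    have Pj: "P j = Polynomial.smult (1 / \<beta> j) (R (Suc i))"
      unfolding 3 by (rule jacobi_poly_step) simp
    show ?thesis
    proof (cases "\<beta> j = 0")
      case True
      then show ?thesis using b F_zero Pj 3 by (simp add: Let_def)
    next
      case False
      then have "lanczos_v A b j = complex_of_real (1 / \<beta> j) \<cdot>\<^sub>v Fr (poly (R (Suc i)))"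
        using w by (simp only: 3 lanczos_v.simps Let_def if_True simp_thms)
      then show ?thesis by (simp only: F_smult Pj poly_smult of_real_mult)
    qed
  qed
qed

lemma lanczos_alpha_eq:
  "1 \<le> j \<Longrightarrow> \<alpha> j = ip (poly (pCons 0 (P j) - Polynomial.smult (\<beta> j) (P (j - 1)))) (poly (P j))"
  by (intro lanczos_w_eq lanczos_v_eq)

lemma lanczos_beta_eq: "1 \<le> j \<Longrightarrow> \<beta> (Suc j) = sqrt (ip (poly (R j)) (poly (R j)))"
  using lanczos_w_eq(1)[OF _ lanczos_v_eq lanczos_v_eq, of j] by (cases j) (simp_all add: vnorm_Fr)

lemma lanczos_beta_nonneg: "0 \<le> \<beta> j"
proof -
  consider "j = 0" | "j = 1" | i where "j = Suc (Suc i)" by (metis One_nat_def not0_implies_Suc)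
  then show ?thesis by cases auto
qed

section \<open>Breakdown and the invariance index\<close>

text \<open>Induction on the degree, splitting off the leading term: \<open>x\<^sup>N\<close> stands for the generator
  \<open>A\<^sup>N b\<close>.\<close>

lemma Fr_in_krylov:
  assumes "degree q < k"
  shows "Fr (poly q) \<in> krylov A b k"
proof -
  interpret vs: vec_space "TYPE(complex)" n .
  define S where "S = (\<lambda>j. (A ^\<^sub>m j) *\<^sub>v b) ` {..<k}"
  have S: "S \<subseteq> carrier_vec n"
    by (auto simp: S_def pow_F)
  have krylov: "krylov A b k = vs.span S"
    using b by (simp add: krylov_def S_def)
  have "N \<le> k \<Longrightarrow> q = 0 \<or> degree q < N \<Longrightarrow> Fr (poly q) \<in> vs.span S" for N
  proof (induction N arbitrary: q)
    case 0
    then show ?case using vs.span_zero F_zero by simp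
  next
    case (Suc N)
    define q' where "q' = q - monom (coeff q N) N"
    have "coeff q' N = 0" by (simp add: q'_def)
    moreover have "degree q' \<le> N"
      unfolding q'_def using Suc.prems by (intro degree_diff_le) (auto intro: degree_monom_le)
    ultimately have "q' = 0 \<or> degree q' < N"
      by (metis le_neq_implies_less leading_coeff_0_iff)
    then have "Fr (poly q') \<in> vs.span S" using Suc by simp
    moreover have "(A ^\<^sub>m N) *\<^sub>v b \<in> vs.span S"
      using Suc.prems S by (intro set_mp[OF vs.in_own_span]) (auto simp: S_def)
    then have "complex_of_real (coeff q N) \<cdot>\<^sub>v Fr (\<lambda>x. x ^ N) \<in> vs.span S"
      using vs.smult_in_span[OF S] by (simp add: pow_F)
    ultimately have "Fr (poly q') + complex_of_real (coeff q N) \<cdot>\<^sub>v Fr (\<lambda>x. x ^ N) \<in> vs.span S"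
      using vs.span_add1[OF S] by blast
    moreover have "Fr (poly q') + complex_of_real (coeff q N) \<cdot>\<^sub>v Fr (\<lambda>x. x ^ N) = Fr (poly q)"
      by (simp add: F_smult F_add q'_def poly_monom)
    ultimately show ?case by simp
  qed
  then show ?thesis using assms krylov by blast
qed

text \<open>At the first breakdown \<open>R\<^sub>j\<close> annihilates \<open>b\<close>, and so does \<open>x\<^sup>k\<^sup>-\<^sup>j R\<^sub>j\<close> for every \<open>k \<ge> j\<close>. Its degree
  is exactly \<open>k\<close>, so \<open>A\<^sup>k b\<close> is a combination of lower powers and the Krylov spaces have stopped
  growing.\<close>

lemma invariance_index_le:
  assumes j: "1 \<le> j" and nz: "\<And>i. 2 \<le> i \<Longrightarrow> i \<le> j \<Longrightarrow> \<beta> i \<noteq> 0" and z: "\<beta> (Suc j) = 0"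
  shows "invariance_index A b \<le> j"
  unfolding invariance_index_def
proof (intro Least_le allI impI)
  fix k assume k: "j \<le> k"
  interpret vs: vec_space "TYPE(complex)" n .
  define S where "S = (\<lambda>j. (A ^\<^sub>m j) *\<^sub>v b) ` {..<k}"
  have S: "S \<subseteq> carrier_vec n"
    by (auto simp: S_def pow_F)
  have krylov: "krylov A b k = vs.span S" "krylov A b (Suc k) = vs.span (insert ((A ^\<^sub>m k) *\<^sub>v b) S)"
    using b by (simp_all add: krylov_def S_def lessThan_Suc)
  have R: "R j \<noteq> 0" "degree (R j) = j" using jacobi_degree(2)[of j \<beta> \<alpha>] j nz by auto
  have "vnorm (Fr (poly (R j))) = 0"
    using z lanczos_beta_eq[OF j] by (simp add: vnorm_Fr)
  then have "Fr (poly (R j)) = 0\<^sub>v n"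
    using vnorm_eq_0_iff[OF F_carrier] by blast
  then have R0: "poly (R j) (d i) = 0 \<or> c $ i = 0" if "i < n" for i
    using F_coordinate[OF that, of "\<lambda>x. complex_of_real (poly (R j) x)"] U'(1) that by simp
  \<comment> \<open>The monic multiple of \<open>R j\<close> of degree \<open>k\<close>; subtracting it from \<open>x\<^sup>k\<close> does not change the
    vector and lowers the degree.\<close>
  define s where "s = Polynomial.smult (1 / lead_coeff (R j)) (monom 1 (k - j) * R j)"
  have s: "degree s = k" "coeff s k = 1"
  proof -
    have "degree (monom 1 (k - j) * R j) = k"
      using R k by (subst degree_mult_eq) (auto simp: degree_monom_eq)
    moreover have "lead_coeff (monom 1 (k - j) * R j) = lead_coeff (R j)"
      by (simp only: lead_coeff_mult lead_coeff_monom mult_1_left)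
    moreover have "lead_coeff (R j) \<noteq> 0"
      using R by (metis leading_coeff_0_iff)
    ultimately show "degree s = k" "coeff s k = 1"
      by (auto simp: s_def)
  qed
  have "degree (monom 1 k - s) \<le> k"
    using s by (intro degree_diff_le) (auto intro: degree_monom_le)
  moreover have "coeff (monom 1 k - s) k = 0" using s by simp
  ultimately have "degree (monom 1 k - s) < k"
    using j k by (metis degree_0 gr0I le_neq_implies_less leading_coeff_0_iff not_one_le_zero order.trans)
  then have "Fr (poly (monom 1 k - s)) \<in> krylov A b k" by (rule Fr_in_krylov)
  moreover have "Fr (poly (monom 1 k - s)) = (A ^\<^sub>m k) *\<^sub>v b"
    unfolding pow_F by (rule F_eqI) (use R0 in \<open>auto simp: F_coordinate poly_monom s_def simp del: index_mult_mat_vec\<close>)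
  ultimately have Ak: "(A ^\<^sub>m k) *\<^sub>v b \<in> vs.span S" by (simp add: krylov)
  show "krylov A b (Suc k) = krylov A b k"
    unfolding krylov
  proof
    show "vs.span (insert ((A ^\<^sub>m k) *\<^sub>v b) S) \<subseteq> vs.span S"
      using Ak vs.in_own_span[OF S] by (intro vs.span_subsetI[OF S]) auto
    show "vs.span S \<subseteq> vs.span (insert ((A ^\<^sub>m k) *\<^sub>v b) S)"
      by (rule vs.span_is_monotone) auto
  qed
qed

lemma lanczos_beta_nonzero:
  assumes "m \<le> invariance_index A b" "2 \<le> i" "i \<le> m"
  shows "\<beta> i \<noteq> 0"
  using assms(2,3)
proof (induction i rule: less_induct)
  case (less i)
  show ?case
  proof
    assume "\<beta> i = 0"
    then have "invariance_index A b \<le> i - 1"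
      using less by (intro invariance_index_le) auto
    then show False using less.prems assms(1) by linarith
  qed
qed

end

section \<open>The error of the Lanczos approximation\<close>

lemma poly_map_of_real: "poly (map_poly complex_of_real p) (complex_of_real x) = complex_of_real (poly p x)"
  by (induction p) (simp_all add: map_poly_pCons)

context spectral_coordinates
begin

text \<open>The inner product is a finite sum, so it may be exchanged with the integral that defines
  \<open>f\<close>.\<close>

lemma ip_stieltjes:
  assumes N_int: "\<And>z. 0 < z \<Longrightarrow> integrable N (\<lambda>t. 1 / (z + t))"
    and f: "\<And>z. 0 < z \<Longrightarrow> f z = (\<integral>t. 1 / (z + t) \<partial>N)"
    and pos: "\<And>i. i < n \<Longrightarrow> 0 < d i"
  shows "integrable N (\<lambda>t. ip h (\<lambda>x. 1 / (x + t)))"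
    and "ip h f = (\<integral>t. ip h (\<lambda>x. 1 / (x + t)) \<partial>N)"
proof -
  have int: "integrable N (\<lambda>t. \<omega> i * h (d i) * (1 / (d i + t)))" if "i \<in> {..<n}" for i
    using that pos N_int by (intro integrable_mult_right) auto
  then show "integrable N (\<lambda>t. ip h (\<lambda>x. 1 / (x + t)))"
    unfolding ip_def by (rule Bochner_Integration.integrable_sum)
  have "(\<integral>t. ip h (\<lambda>x. 1 / (x + t)) \<partial>N) = (\<Sum>i<n. \<integral>t. \<omega> i * h (d i) * (1 / (d i + t)) \<partial>N)"
    unfolding ip_def using int by (rule Bochner_Integration.integral_sum)
  also have "\<dots> = ip h f"
    unfolding ip_def using pos by (intro sum.cong refl) (simp only: integral_mult_right_zero f lessThan_iff)
  finally show "ip h f = (\<integral>t. ip h (\<lambda>x. 1 / (x + t)) \<partial>N)" ..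
qed

lemma lanczos_V_carrier: "lanczos_V A b m \<in> carrier_mat n m"
  using b mat_of_cols_carrier(1)[of n "map (lanczos_v A b) [1..<Suc m]"]
  by (simp add: lanczos_V_def del: upt_Suc)

lemma lanczos_V_index:
  assumes "i < n" "j < m"
  shows "lanczos_V A b m $$ (i, j) = Fr (poly (P (Suc j))) $ i"
  using assms b by (simp add: lanczos_V_def mat_of_cols_index lanczos_v_eq del: upt_Suc)

lemma lanczos_V_col:
  assumes "j < m"
  shows "col (lanczos_V A b m) j = Fr (poly (P (Suc j)))"
  using assms lanczos_V_carrier[of m] by (intro eq_vecI) (auto simp: lanczos_V_index)

lemma lanczos_V_adjoint_mult:
  assumes j: "j < m" and X: "X \<in> carrier_mat n m" and k: "k < m" "col X k = Fr g"
  shows "(mat_adjoint (lanczos_V A b m) * X) $$ (j, k) = complex_of_real (ip g (poly (P (Suc j))))"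
proof -
  have Xk: "X $$ (i, k) = Fr g $ i" if "i < n" for i
    using arg_cong[OF k(2), of "\<lambda>v. v $ i"] that X k(1) by simp
  have "(mat_adjoint (lanczos_V A b m) * X) $$ (j, k)
      = (\<Sum>i<n. mat_adjoint (lanczos_V A b m) $$ (j, i) * X $$ (i, k))"
    using lanczos_V_carrier[of m] X j k by (intro index_mult_mat_sum) auto
  also have "\<dots> = Fr g \<bullet>c Fr (poly (P (Suc j)))"
    using lanczos_V_carrier[of m] j
    by (subst cscalar_prod_sum[OF F_carrier])
      (auto simp: Xk lanczos_V_index mult.commute intro!: sum.cong)
  finally show ?thesis by (simp only: Fr_inner)
qed

lemma lanczos_V_mult_real:
  assumes u: "u \<in> carrier_vec m" "\<And>j. j < m \<Longrightarrow> u $ j = complex_of_real (s (Suc j))"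
  shows "lanczos_V A b m *\<^sub>v u = Fr (poly (\<Sum>j=1..m. Polynomial.smult (s j) (P j)))"
proof (rule eq_vecI)
  fix i assume "i < dim_vec (Fr (poly (\<Sum>j=1..m. Polynomial.smult (s j) (P j))))"
  then have i: "i < n" by simp
  have "(lanczos_V A b m *\<^sub>v u) $ i = (\<Sum>j<m. \<Sum>r<n. U $$ (i, r) * (of_real (poly (P (Suc j)) (d r)) * c $ r) * of_real (s (Suc j)))"
    using u i by (subst index_mult_mat_vec_sum[OF lanczos_V_carrier])
      (auto simp: lanczos_V_index F_index sum_distrib_right simp del: of_real_mult intro!: sum.cong)
  also have "\<dots> = (\<Sum>r<n. \<Sum>j<m. U $$ (i, r) * (of_real (poly (P (Suc j)) (d r)) * c $ r) * of_real (s (Suc j)))"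
    by (rule sum.swap)
  also have "\<dots> = Fr (poly (\<Sum>j=1..m. Polynomial.smult (s j) (P j))) $ i"
    by (simp add: F_index[OF i] poly_sum sum.atLeast1_atMost_eq sum_distrib_left sum_distrib_right mult_ac)
  finally show "(lanczos_V A b m *\<^sub>v u) $ i = Fr (poly (\<Sum>j=1..m. Polynomial.smult (s j) (P j))) $ i" .
qed (use lanczos_V_carrier[of m] in auto)

text \<open>The quantities \<open>l\<close> and \<open>L\<close> are arbitrary bounds for the eigenvalues here. The last conclusion
  is the estimate of \<open>\<beta>\<^sub>m\<^sub>+\<^sub>1\<close> by which the error bound turns into one in terms of the condition
  number.\<close>

theorem lanczos_stieltjes_error:
  assumes b1: "vnorm b = 1" and l: "0 < l" "\<And>i. i < n \<Longrightarrow> l \<le> d i"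
    and herm: "hermitian_mat A" and f: "stieltjes_function f"
    and m: "1 \<le> m" "m \<le> invariance_index A b"
  obtains p where "is_arg_min (\<lambda>q. vnorm (mat_fun f A *\<^sub>v b - poly_mat q A *\<^sub>v b)) (\<lambda>q. degree q \<le> m - 1) p"
    and "vnorm (mat_fun f A *\<^sub>v b - lanczos_approx f A b m)
      \<le> (1 + \<beta> (m + 1) / l) * vnorm (mat_fun f A *\<^sub>v b - poly_mat p A *\<^sub>v b)"
    and "\<And>L. (\<And>i. i < n \<Longrightarrow> d i \<le> L) \<Longrightarrow> 0 \<le> L \<Longrightarrow> \<beta> (m + 1) \<le> L"
proof -
  have pos: "0 < d i" if "i < n" for i using l that by force
  interpret lp: lanczos_polynomials n \<omega> d \<alpha> \<beta> m
  proof
    have "ip (\<lambda>_. 1) (\<lambda>_. 1) = (vnorm b)\<^sup>2"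
      using vnorm_Fr[of "\<lambda>_. 1"] ip_self_nonneg[of "\<lambda>_. 1"] F_one by simp
    then show "ip (\<lambda>_. 1) (\<lambda>_. 1) = 1" using b1 by simp
    show "(\<beta> (Suc j))\<^sup>2 = ip (poly (R j)) (poly (R j))" if "1 \<le> j" for j
      using lanczos_beta_eq[OF that] ip_self_nonneg by simp
  qed (use m lanczos_alpha_eq lanczos_beta_nonneg lanczos_beta_nonzero[OF m(2)] in auto)
  define V where "V = lanczos_V A b m"
  define T where "T = lanczos_T A b m"
  define p where "p = map_poly complex_of_real (lp.best_approx f)"
  define E where "E = vnorm (Fr (\<lambda>x. f x - poly (lp.best_approx f) x))"
  have E: "E = sqrt (ip (\<lambda>x. f x - poly (lp.best_approx f) x) (\<lambda>x. f x - poly (lp.best_approx f) x))"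
    by (simp only: E_def vnorm_Fr)
  have V: "V \<in> carrier_mat n m" by (simp add: V_def lanczos_V_carrier)
  have p_err: "vnorm (mat_fun f A *\<^sub>v b - poly_mat p A *\<^sub>v b) = E"
    by (simp add: mat_fun_F poly_mat_F F_diff p_def poly_map_of_real E_def)
  have argmin: "is_arg_min (\<lambda>q. vnorm (mat_fun f A *\<^sub>v b - poly_mat q A *\<^sub>v b)) (\<lambda>q. degree q \<le> m - 1) p"
    unfolding is_arg_min_def
  proof (intro conjI notI)
    show "degree p \<le> m - 1"
      unfolding p_def using degree_map_poly_le lp.degree_best_approx by (rule order_trans)
    assume "\<exists>q. degree q \<le> m - 1 \<and> vnorm (mat_fun f A *\<^sub>v b - poly_mat q A *\<^sub>v b)
      < vnorm (mat_fun f A *\<^sub>v b - poly_mat p A *\<^sub>v b)"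
    then obtain q where q: "degree q \<le> m - 1" "vnorm (mat_fun f A *\<^sub>v b - poly_mat q A *\<^sub>v b) < E"
      unfolding p_err by blast
    obtain q' where q': "degree q' \<le> m - 1"
      "sqrt (ip (\<lambda>x. f x - poly q' x) (\<lambda>x. f x - poly q' x)) \<le> vnorm (mat_fun f A *\<^sub>v b - poly_mat q A *\<^sub>v b)"
      using vnorm_Fr_sub_poly[OF q(1), of f] unfolding mat_fun_F poly_mat_F .
    have "E \<le> sqrt (ip (\<lambda>x. f x - poly q' x) (\<lambda>x. f x - poly q' x))"
      unfolding E by (intro real_sqrt_le_mono lp.best_approx_minimal q'(1))
    then show False using q' q by linarith
  qed
  have VV: "mat_adjoint V * V = 1\<^sub>m m"
  proof (rule eq_matI)
    fix i j assume "i < dim_row (1\<^sub>m m :: complex mat)" "j < dim_col (1\<^sub>m m :: complex mat)"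
    then show "(mat_adjoint V * V) $$ (i, j) = 1\<^sub>m m $$ (i, j)"
      using lanczos_V_adjoint_mult[of i m V j "poly (P (Suc j))"] V lp.P_orthonormal[of "Suc j" "Suc i"]
      by (auto simp: V_def lanczos_V_col simp del: index_mult_mat)
  qed (use V in auto)
  have AV: "A * V \<in> carrier_mat n m" using A V by simp
  have T_eq: "T = mat_adjoint V * A * V" by (simp add: T_def V_def lanczos_T_def)
  have T: "T \<in> carrier_mat m m" unfolding T_eq using A V by (rule compression_carrier)
  have T_index: "T $$ (j, k) = complex_of_real (ip (poly (pCons 0 (P (Suc j)))) (poly (P (Suc k))))"
    if jk: "j < m" "k < m" for j k
  proof -
    have "col (A * V) k = A *\<^sub>v Fr (poly (P (Suc k)))"
      using A V jk by (intro eq_vecI) (simp_all add: V_def lanczos_V_col)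
    also have "\<dots> = Fr (poly (pCons 0 (P (Suc k))))"
      by (simp add: mult_F)
    finally have "(mat_adjoint V * (A * V)) $$ (j, k) = complex_of_real (ip (poly (pCons 0 (P (Suc k)))) (poly (P (Suc j))))"
      using jk AV unfolding V_def by (intro lanczos_V_adjoint_mult) auto
    moreover have "T = mat_adjoint V * (A * V)"
      unfolding T_eq using A V by (intro assoc_mult_mat) auto
    moreover have "ip (poly (pCons 0 (P (Suc k)))) (poly (P (Suc j))) = ip (poly (pCons 0 (P (Suc j)))) (poly (P (Suc k)))"
      by (subst ip_poly_shift) (rule ip_commute)
    ultimately show ?thesis by simp
  qed
  have "hermitian_mat T"
    unfolding T_eq by (rule compression_hermitian[OF A herm V])
  then obtain Q \<theta> where Q: "spectral_decomposition T Q \<theta>"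
    using spectral_decomposition_exists[OF T] by blast
  have \<theta>: "l \<le> \<theta> k" if "k < m" for k
    using compression_eigenvalue_ge[OF U A l(2) V VV Q[unfolded T_eq] that] .
  obtain N where N_nonneg: "\<And>t. t \<in> space N \<Longrightarrow> 0 \<le> t"
    and N_int: "\<And>z. 0 < z \<Longrightarrow> integrable N (\<lambda>t. 1 / (z + t))"
    and fN: "\<And>z. 0 < z \<Longrightarrow> f z = (\<integral>t. 1 / (z + t) \<partial>N)"
    using stieltjes_function_integral[OF f] by metis
  define r where "r t = (\<lambda>x. 1 / (x + t))" for t :: real
  define g where "g t = ip (poly (R m)) (r t)" for t
  \<comment> \<open>These are \<open>V\<^sup>* (A + t)\<^sup>-\<^sup>1 b\<close> and \<open>V\<^sup>* f(A) b\<close>; the \<open>Suc\<close> comes from \<open>P\<close> being indexed from \<open>1\<close>.\<close>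
  define y where "y t = Matrix.vec m (\<lambda>j. complex_of_real (ip (poly (P (Suc j))) (r t)))" for t
  define u where "u = Matrix.vec m (\<lambda>j. complex_of_real (ip (poly (P (Suc j))) f))"
  note stieltjes = ip_stieltjes[OF N_int fN pos, folded r_def]
  have perturbed: "T *\<^sub>v y t + complex_of_real t \<cdot>\<^sub>v y t = unit_vec m 0 - complex_of_real (g t) \<cdot>\<^sub>v unit_vec m (m - 1)"
    if t: "t \<in> space N" for t
  proof (rule eq_vecI)
    fix j assume "j < dim_vec (unit_vec m 0 - complex_of_real (g t) \<cdot>\<^sub>v unit_vec m (m - 1))"
    then have j: "j < m" by simp
    have "(T *\<^sub>v y t) $ j = (\<Sum>k<m. T $$ (j, k) * y t $ k)"
      using j by (intro index_mult_mat_vec_sum[OF T]) (simp_all add: y_def)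
    also have "\<dots> = of_real (\<Sum>k<m. ip (poly (pCons 0 (P (Suc j)))) (poly (P (Suc k))) * ip (poly (P (Suc k))) (r t))"
      using j by (simp add: T_index y_def del: poly_pCons)
    also have "(\<Sum>k<m. ip (poly (pCons 0 (P (Suc j)))) (poly (P (Suc k))) * ip (poly (P (Suc k))) (r t))
        = ip (poly (pCons 0 (P (Suc j)))) (r t) - (if Suc j = m then g t else 0)"
      using lp.compressed_shift[of "Suc j" "r t"] j by (simp add: sum.atLeast1_atMost_eq g_def)
    finally have Ty: "(T *\<^sub>v y t) $ j = of_real (ip (poly (pCons 0 (P (Suc j)))) (r t) - (if Suc j = m then g t else 0))" .
    have "ip (poly (pCons 0 (P (Suc j)))) (r t) + t * ip (poly (P (Suc j))) (r t)
        = (\<Sum>i<n. \<omega> i * poly (P (Suc j)) (d i) * ((d i + t) * r t (d i)))"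
      by (simp add: ip_def algebra_simps sum.distrib sum_distrib_left)
    also have "\<dots> = ip (poly (P (Suc j))) (poly (P 1))"
      unfolding ip_def using pos N_nonneg[OF t] by (intro sum.cong) (fastforce simp: r_def)+
    also have "\<dots> = (if j = 0 then 1 else 0)"
      using lp.P_orthonormal[of "Suc j" 1] j by simp
    finally have "ip (poly (pCons 0 (P (Suc j)))) (r t) - (if Suc j = m then g t else 0) + t * ip (poly (P (Suc j))) (r t)
        = (if j = 0 then 1 else 0) - (if Suc j = m then g t else 0)" by simp
    then have "complex_of_real (ip (poly (pCons 0 (P (Suc j)))) (r t) - (if Suc j = m then g t else 0)) + of_real t * of_real (ip (poly (P (Suc j))) (r t))
        = of_real ((if j = 0 then 1 else 0) - (if Suc j = m then g t else 0))"
      by (simp only: of_real_add[symmetric] of_real_mult[symmetric])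
    moreover have "(T *\<^sub>v y t + complex_of_real t \<cdot>\<^sub>v y t) $ j = (T *\<^sub>v y t) $ j + of_real t * of_real (ip (poly (P (Suc j))) (r t))"
      using T j by (simp add: y_def del: index_mult_mat_vec)
    ultimately show "(T *\<^sub>v y t + complex_of_real t \<cdot>\<^sub>v y t) $ j
        = (unit_vec m 0 - complex_of_real (g t) \<cdot>\<^sub>v unit_vec m (m - 1)) $ j"
      unfolding Ty using j m by (auto simp: unit_vec_def)
  qed (use T in \<open>auto simp: y_def\<close>)
  have g_sign: "(\<forall>t\<in>space N. 0 \<le> g t) \<or> (\<forall>t\<in>space N. g t \<le> 0)"
    using lp.residual_resolvent_one_signed[OF pos] N_nonneg unfolding g_def r_def by blast
  have g_int: "integrable N g"
    unfolding g_def[abs_def] by (rule stieltjes(1))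
  have y: "y t \<in> carrier_vec m" for t by (simp add: y_def)
  have y_int: "integrable N (\<lambda>t. y t $ j)" if "j < m" for j
    using that stieltjes(1) by (auto simp: y_def intro!: integrable_of_real)
  have u: "u \<in> carrier_vec m" by (simp add: u_def)
  have u_int: "u $ j = (\<integral>t. y t $ j \<partial>N)" if "j < m" for j
    using that stieltjes(2) by (simp add: y_def u_def)
  have "vnorm (u - mat_fun f T *\<^sub>v unit_vec m 0)
      \<le> (1 / l) * \<bar>\<integral>t. g t \<partial>N\<bar> * vnorm (unit_vec m (m - 1))"
    by (rule perturbed_resolvent_integral[OF N_nonneg N_int fN T Q l(1) \<theta> _ _ g_int g_sign y y_int u u_int perturbed])
      auto
  moreover have "vnorm (unit_vec m (m - 1)) = 1"
  proof -
    have "(unit_vec m (m - 1) :: complex vec) \<bullet>c unit_vec m (m - 1) = 1" using m by simp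
    then have "(vnorm (unit_vec m (m - 1)))\<^sup>2 = 1" by (simp only: cscalar_prod_self of_real_eq_1_iff)
    then show ?thesis by (simp add: power2_eq_1_iff) (metis vnorm_nonneg neg_0_le_iff_le not_one_le_zero)
  qed
  moreover have "\<bar>\<integral>t. g t \<partial>N\<bar> \<le> \<beta> (m + 1) * E"
    using lp.residual_coefficient_le[of f] stieltjes(2)[of "poly (R m)"] by (simp add: g_def E)
  ultimately have coeff_err: "vnorm (u - mat_fun f T *\<^sub>v unit_vec m 0) \<le> \<beta> (m + 1) / l * E"
    using l(1) by (simp add: divide_right_mono order_trans[OF _ divide_right_mono])
  define s where "s = mat_fun f T *\<^sub>v unit_vec m 0"
  have s: "s \<in> carrier_vec m"
    unfolding s_def using mat_fun_eq[OF Q] T spectral_decompositionD(1)[OF Q T]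
    by (intro mult_mat_vec_carrier) auto
  have Vu: "V *\<^sub>v u = Fr (poly (lp.best_approx f))"
    unfolding V_def lp.best_approx_def
    by (intro lanczos_V_mult_real) (auto simp: u_def ip_commute)
  \<comment> \<open>Split into the component orthogonal to the Krylov space and the one inside it.\<close>
  have "Fr f - V *\<^sub>v s = (Fr f - V *\<^sub>v u) + V *\<^sub>v (u - s)"
    using V u s by (intro eq_vecI) (auto simp: mult_minus_distrib_mat_vec[of _ n m] simp del: index_mult_mat_vec)
  also have "vnorm \<dots> \<le> vnorm (Fr f - V *\<^sub>v u) + vnorm (V *\<^sub>v (u - s))"
    using V u s by (intro vnorm_add_le[of _ n]) (auto simp: Vu F_diff)
  also have "vnorm (Fr f - V *\<^sub>v u) = E"
    by (simp add: Vu F_diff E_def)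
  also have "vnorm (V *\<^sub>v (u - s)) = vnorm (u - s)"
    using u s by (intro isometry_vnorm[OF V VV]) auto
  also have "E + vnorm (u - s) \<le> (1 + \<beta> (m + 1) / l) * E"
    using coeff_err by (simp add: s_def distrib_right)
  finally have "vnorm (mat_fun f A *\<^sub>v b - lanczos_approx f A b m) \<le> (1 + \<beta> (m + 1) / l) * E"
    by (simp add: mat_fun_F lanczos_approx_def s_def V_def T_def)
  moreover have "\<beta> (m + 1) \<le> L" if "\<And>i. i < n \<Longrightarrow> d i \<le> L" "0 \<le> L" for L
    using lp.beta_le[of L] that pos by (simp add: abs_of_pos)
  ultimately show ?thesis
    using that argmin p_err by metis
qed

end

theorem theorem3p1:
  fixes A :: "complex mat" and b :: "complex vec" and f :: "real \<Rightarrow> real" and n m :: nat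
  assumes "A \<in> carrier_mat n n" and "hermitian_pos_def A"
    and "b \<in> carrier_vec n" and "vnorm b = 1"
    and "stieltjes_function f"
    and "1 \<le> m" and "m \<le> invariance_index A b"
  shows "\<exists>p. is_arg_min (\<lambda>q. vnorm (mat_fun f A *\<^sub>v b - poly_mat q A *\<^sub>v b))
                        (\<lambda>q. degree q \<le> m - 1) p \<and>
    vnorm (mat_fun f A *\<^sub>v b - lanczos_approx f A b m)
      \<le> (1 + lanczos_beta A b (m + 1) * (lambda_max A / (lambda_min A)\<^sup>2)) *
          vnorm (mat_fun f A *\<^sub>v b - poly_mat p A *\<^sub>v b) \<and>
    (1 + lanczos_beta A b (m + 1) * (lambda_max A / (lambda_min A)\<^sup>2)) *
        vnorm (mat_fun f A *\<^sub>v b - poly_mat p A *\<^sub>v b)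
      \<le> (1 + (condition_number A)\<^sup>2) *
          vnorm (mat_fun f A *\<^sub>v b - poly_mat p A *\<^sub>v b)"
proof -
  have herm: "hermitian_mat A" using assms(2) by (simp add: hermitian_pos_def_def)
  obtain U d where U: "spectral_decomposition A U d"
    using spectral_decomposition_exists[OF assms(1) herm] .
  interpret spectral_coordinates A U d b n
    using assms U by unfold_locales auto
  have d_pos: "0 < d i" if "i < n" for i
  proof -
    obtain x where x: "x \<in> carrier_vec n" "x \<bullet>c x = 1" "A *\<^sub>v x = complex_of_real (d i) \<cdot>\<^sub>v x"
      using spectral_eigenvector[OF U assms(1) \<open>i < n\<close>] .
    then have "x \<noteq> 0\<^sub>v n" by auto
    then have "0 < Re ((A *\<^sub>v x) \<bullet>c x)"
      using assms(1,2) x(1) by (auto simp: hermitian_pos_def_def)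
    then show ?thesis using x by simp
  qed
  have "n \<noteq> 0"
  proof
    assume "n = 0"
    then have "dim_vec b = 0" using assms(3) by (metis carrier_vecD)
    then show False using assms(4) by (simp add: vnorm_def)
  qed
  then have ne: "d ` {..<n} \<noteq> {}" by auto
  have lmin: "lambda_min A = Min (d ` {..<n})" and lmax: "lambda_max A = Max (d ` {..<n})"
    by (simp_all add: lambda_min_def lambda_max_def real_eigenvalues[OF U assms(1)])
  define l where "l = lambda_min A"
  define L where "L = lambda_max A"
  have l_le: "l \<le> d i" and L_ge: "d i \<le> L" if "i < n" for i
    using that by (auto simp: l_def L_def lmin lmax)
  have l: "0 < l" using Min_in[OF _ ne] d_pos by (auto simp: l_def lmin)
  have lL: "l \<le> L" using l_le[of 0] L_ge[of 0] \<open>n \<noteq> 0\<close> by linarith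
  obtain p where p: "is_arg_min (\<lambda>q. vnorm (mat_fun f A *\<^sub>v b - poly_mat q A *\<^sub>v b)) (\<lambda>q. degree q \<le> m - 1) p"
    and err: "vnorm (mat_fun f A *\<^sub>v b - lanczos_approx f A b m)
      \<le> (1 + \<beta> (m + 1) / l) * vnorm (mat_fun f A *\<^sub>v b - poly_mat p A *\<^sub>v b)"
    and \<beta>_le: "\<And>L. (\<And>i. i < n \<Longrightarrow> d i \<le> L) \<Longrightarrow> 0 \<le> L \<Longrightarrow> \<beta> (m + 1) \<le> L"
    using lanczos_stieltjes_error[OF assms(4) l l_le herm assms(5-7)] by metis
  have "\<beta> (m + 1) / l \<le> \<beta> (m + 1) * (L / l\<^sup>2)"
  proof -
    have "1 / l \<le> L / l\<^sup>2" using l lL by (simp add: field_simps power2_eq_square)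
    then show ?thesis using mult_left_mono[OF _ lanczos_beta_nonneg] by fastforce
  qed
  then have 1: "(1 + \<beta> (m + 1) / l) * x \<le> (1 + \<beta> (m + 1) * (L / l\<^sup>2)) * x" if "0 \<le> x" for x
    using that by (intro mult_right_mono) auto
  have "\<beta> (m + 1) \<le> L"
    using \<beta>_le[OF L_ge] l lL by linarith
  then have "\<beta> (m + 1) * (L / l\<^sup>2) \<le> L * (L / l\<^sup>2)"
    using l lL by (intro mult_right_mono) auto
  also have "\<dots> = (condition_number A)\<^sup>2"
    by (simp add: condition_number_def l_def L_def power2_eq_square)
  finally have "(1 + \<beta> (m + 1) * (L / l\<^sup>2)) * x \<le> (1 + (condition_number A)\<^sup>2) * x" if "0 \<le> x" for x
    using that by (intro mult_right_mono) auto
  then show ?thesis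
    using p order_trans[OF err 1] unfolding l_def L_def by (intro exI[of _ p]) simp
qed

end
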